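(* Let $M^3$ be an indefinite improper affine hypersphere of $\mathbb{R}^4$ which admits a pointwise $S_3$-symmetry, and assume that the invariant functions satisfy $(\alpha_{22},\alpha_{23})\neq(0,0)$ everywhere. Then $M^3$ admits coordinates $(t,v,w)$ and there are functions $\eta,k$ of $(v,w)$ such that $$\alpha_{22}=\frac{t}{t^2+\eta^2},\quad \alpha_{23}=-\frac{\eta}{t^2+\eta^2},\quad a_6=\frac{e^k}{\sqrt{t^2+\eta^2}},$$ where $\eta,k$ satisfy $$\Big(\tfrac{\partial^2}{\partial v^2}+\tfrac{\partial^2}{\partial w^2}\Big)\eta=2e^{-\frac23k}\eta,\qquad \Big(\tfrac{\partial^2}{\partial v^2}+\tfrac{\partial^2}{\partial w^2}\Big)k=3e^{-\frac23k}\big(2e^{2k}-1\big).$$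
   Context: Setting: $\varphi:M^3\to\mathbb{R}^4$ nondegenerate hypersurface with Blaschke normal $\xi$, $D_X\varphi_*Y=\varphi_*(\nabla_XY)+h(X,Y)\xi$, $D_X\xi=-\varphi_*(SX)$; $h$ affine metric (Lorentzian), $K=\nabla-\hat\nabla$ the difference tensor, $\hat\nabla$ the Levi-Civita connection of $h$. Affine hypersphere: $S=H\,\mathrm{Id}$, $H$ constant; improper if $H=0$. Pointwise $G$-symmetry: for every $p$ the group of $h_p$-isometries $L$ of $T_pM$ with $\det L=1$ and $K_p(LX,LY)=LK_p(X,Y)$ is isomorphic to $G$. Under pointwise $S_3$-symmetry there is locally an $h$-orthonormal frame $\{T,V,W\}$ ($h(T,T)=-1$, $h(V,V)=h(W,W)=1$) and a function $a_6>0$ with $K(T,X)=0$ for all $X$, $K(V,V)=a_6V$, $K(V,W)=-a_6W$, $K(W,W)=-a_6V$; the invariant functions are $\alpha_{22}:=h(\hat\nabla_VT,V)$ and $\alpha_{23}:=h(\hat\nabla_VT,W)$. (The paper denotes the function $\eta$ by $h$; renamed to avoid clash with the metric.) *)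

theory Defs
  imports "HOL-Analysis.Analysis" "HOL-Algebra.Sym_Groups"
begin

text \<open>Local model: the hypersurface is an immersion phi of an open set U of R^3
  (a coordinate patch of M^3) into R^4.  Tangent vectors at p are vectors of R^3;
  vector fields are maps R^3 to R^3.\<close>

type_synonym R3 = "real^3"
type_synonym R4 = "real^4"

text \<open>Directional derivative of f at p in direction u (Frechet derivative).\<close>
definition dd :: "('a::real_normed_vector \<Rightarrow> 'b::real_normed_vector) \<Rightarrow> 'a \<Rightarrow> 'a \<Rightarrow> 'b" where
  "dd f p u = frechet_derivative f (at p) u"

text \<open>Partial derivative along the i-th coordinate axis and C-infinity smoothness.\<close>
definition pd :: "'n \<Rightarrow> (real^'n \<Rightarrow> 'b::real_normed_vector) \<Rightarrow> real^'n \<Rightarrow> 'b" where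
  "pd i f x = frechet_derivative f (at x) (axis i 1)"

fun iter_pd :: "'n list \<Rightarrow> (real^'n \<Rightarrow> 'b::real_normed_vector) \<Rightarrow> real^'n \<Rightarrow> 'b" where
  "iter_pd [] f = f"
| "iter_pd (i # is) f = pd i (iter_pd is f)"

definition Cinf :: "(real^'n) set \<Rightarrow> (real^'n \<Rightarrow> 'b::real_normed_vector) \<Rightarrow> bool" where
  "Cinf U f \<longleftrightarrow> (\<forall>is. iter_pd is f differentiable_on U)"

text \<open>Euclidean Laplacian.\<close>
definition laplacian :: "(real^'n \<Rightarrow> real) \<Rightarrow> real^'n \<Rightarrow> real" where
  "laplacian f x = (\<Sum>i\<in>UNIV. pd i (pd i f) x)"

text \<open>Determinant of the 4x4 matrix with rows phi_* e_1, phi_* e_2, phi_* e_3, xi.\<close>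
definition vol4 :: "(R3 \<Rightarrow> R4) \<Rightarrow> (R3 \<Rightarrow> R4) \<Rightarrow> R3 \<Rightarrow> real" where
  "vol4 \<phi> \<xi> p = det (vector [dd \<phi> p (axis 1 1), dd \<phi> p (axis 2 1), dd \<phi> p (axis 3 1), \<xi> p] :: real^4^4)"

text \<open>Matrix of a bilinear form in the standard basis.\<close>
definition gram :: "(R3 \<Rightarrow> R3 \<Rightarrow> real) \<Rightarrow> real^3^3" where
  "gram b = (\<chi> i j. b (axis i 1) (axis j 1))"

text \<open>Gauss formula D_X phi_* Y = phi_*(nabla_X Y) + h(X,Y) xi, written for the
  second derivative: with nabla_X Y = DY(X) + Gamma(X,Y) it reads
  D^2 phi(u,v) = phi_*(Gamma(u,v)) + h(u,v) xi (h and Gamma bilinear).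
  The Blaschke normal is characterised by: transversal, equiaffine
  (D xi tangent) and the volume condition det(phi_* e_i, xi)^2 = |det h|.\<close>
definition blaschke_structure ::
  "R3 set \<Rightarrow> (R3 \<Rightarrow> R4) \<Rightarrow> (R3 \<Rightarrow> R4) \<Rightarrow> (R3 \<Rightarrow> R3 \<Rightarrow> R3 \<Rightarrow> real)
     \<Rightarrow> (R3 \<Rightarrow> R3 \<Rightarrow> R3 \<Rightarrow> R3) \<Rightarrow> (R3 \<Rightarrow> R3 \<Rightarrow> R3) \<Rightarrow> bool" where
  "blaschke_structure U \<phi> \<xi> h \<Gamma> S \<longleftrightarrow>
     open U \<and> Cinf U \<phi> \<and> Cinf U \<xi> \<and>
     (\<forall>p\<in>U. bilinear (h p) \<and> bilinear (\<Gamma> p) \<and> linear (S p) \<and>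
        (\<forall>u v. dd (\<lambda>q. dd \<phi> q v) p u = dd \<phi> p (\<Gamma> p u v) + h p u v *\<^sub>R \<xi> p) \<and>
        (\<forall>u. dd \<xi> p u = - dd \<phi> p (S p u)) \<and>
        det (gram (h p)) \<noteq> 0 \<and>
        (vol4 \<phi> \<xi> p)\<^sup>2 = \<bar>det (gram (h p))\<bar>)"

text \<open>Affine hypersphere with constant H: S = H Id; improper: H = 0.\<close>
definition improper_affine_hypersphere ::
  "R3 set \<Rightarrow> (R3 \<Rightarrow> R3 \<Rightarrow> R3) \<Rightarrow> bool" where
  "improper_affine_hypersphere U S \<longleftrightarrow> (\<forall>p\<in>U. \<forall>u. S p u = (0::real) *\<^sub>R u)"

text \<open>Indefinite affine metric.\<close>
definition indefinite :: "R3 set \<Rightarrow> (R3 \<Rightarrow> R3 \<Rightarrow> R3 \<Rightarrow> real) \<Rightarrow> bool" where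
  "indefinite U h \<longleftrightarrow> (\<forall>p\<in>U. (\<exists>u. h p u u > 0) \<and> (\<exists>u. h p u u < 0))"

text \<open>Christoffel tensor of the Levi-Civita connection of h relative to the flat
  coordinate connection (Koszul formula for constant vector fields):
  hat nabla_X Y = DY(X) + lc_chr(X,Y).\<close>
definition lc_chr :: "(R3 \<Rightarrow> R3 \<Rightarrow> R3 \<Rightarrow> real) \<Rightarrow> R3 \<Rightarrow> R3 \<Rightarrow> R3 \<Rightarrow> R3" where
  "lc_chr h p u v = (THE z. \<forall>w. h p z w =
      (dd (\<lambda>q. h q v w) p u + dd (\<lambda>q. h q u w) p v - dd (\<lambda>q. h q u v) p w) / 2)"

definition lc_cov :: "(R3 \<Rightarrow> R3 \<Rightarrow> R3 \<Rightarrow> real) \<Rightarrow> (R3 \<Rightarrow> R3) \<Rightarrow> (R3 \<Rightarrow> R3) \<Rightarrow> R3 \<Rightarrow> R3" where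
  "lc_cov h X Y p = dd Y p (X p) + lc_chr h p (X p) (Y p)"

text \<open>Difference tensor K = nabla - hat nabla.\<close>
definition diff_tensor ::
  "(R3 \<Rightarrow> R3 \<Rightarrow> R3 \<Rightarrow> real) \<Rightarrow> (R3 \<Rightarrow> R3 \<Rightarrow> R3 \<Rightarrow> R3) \<Rightarrow> R3 \<Rightarrow> R3 \<Rightarrow> R3 \<Rightarrow> R3" where
  "diff_tensor h \<Gamma> p u v = \<Gamma> p u v - lc_chr h p u v"

text \<open>The group of h_p-isometries of determinant 1 preserving K_p.\<close>
definition sym_grp :: "(R3 \<Rightarrow> R3 \<Rightarrow> real) \<Rightarrow> (R3 \<Rightarrow> R3 \<Rightarrow> R3) \<Rightarrow> (real^3^3) monoid" where
  "sym_grp hp Kp = \<lparr> carrier = {L. det L = 1 \<and>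
       (\<forall>x y. hp (L *v x) (L *v y) = hp x y) \<and>
       (\<forall>x y. Kp (L *v x) (L *v y) = L *v Kp x y)},
     mult = (**), one = mat 1 \<rparr>"

definition pointwise_S3_symmetry ::
  "R3 set \<Rightarrow> (R3 \<Rightarrow> R3 \<Rightarrow> R3 \<Rightarrow> real) \<Rightarrow> (R3 \<Rightarrow> R3 \<Rightarrow> R3 \<Rightarrow> R3) \<Rightarrow> bool" where
  "pointwise_S3_symmetry U h K \<longleftrightarrow> (\<forall>p\<in>U. sym_grp (h p) (K p) \<cong> sym_group 3)"

text \<open>The S_3 frame {T,V,W} with function a6 > 0.\<close>
definition S3_frame ::
  "R3 set \<Rightarrow> (R3 \<Rightarrow> R3 \<Rightarrow> R3 \<Rightarrow> real) \<Rightarrow> (R3 \<Rightarrow> R3 \<Rightarrow> R3 \<Rightarrow> R3)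
     \<Rightarrow> (R3 \<Rightarrow> R3) \<Rightarrow> (R3 \<Rightarrow> R3) \<Rightarrow> (R3 \<Rightarrow> R3) \<Rightarrow> (R3 \<Rightarrow> real) \<Rightarrow> bool" where
  "S3_frame U h K T V W a6 \<longleftrightarrow>
     Cinf U T \<and> Cinf U V \<and> Cinf U W \<and> Cinf U a6 \<and>
     (\<forall>p\<in>U. h p (T p) (T p) = -1 \<and> h p (V p) (V p) = 1 \<and> h p (W p) (W p) = 1 \<and>
        h p (T p) (V p) = 0 \<and> h p (T p) (W p) = 0 \<and> h p (V p) (W p) = 0 \<and>
        a6 p > 0 \<and>
        (\<forall>x. K p (T p) x = 0) \<and>
        K p (V p) (V p) = a6 p *\<^sub>R V p \<and>
        K p (V p) (W p) = - a6 p *\<^sub>R W p \<and>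
        K p (W p) (W p) = - a6 p *\<^sub>R V p)"

text \<open>Invariant functions alpha_22 = h(hat nabla_V T, V), alpha_23 = h(hat nabla_V T, W).\<close>
definition alpha22 :: "(R3 \<Rightarrow> R3 \<Rightarrow> R3 \<Rightarrow> real) \<Rightarrow> (R3 \<Rightarrow> R3) \<Rightarrow> (R3 \<Rightarrow> R3) \<Rightarrow> R3 \<Rightarrow> real" where
  "alpha22 h T V p = h p (lc_cov h V T p) (V p)"

definition alpha23 :: "(R3 \<Rightarrow> R3 \<Rightarrow> R3 \<Rightarrow> real) \<Rightarrow> (R3 \<Rightarrow> R3) \<Rightarrow> (R3 \<Rightarrow> R3) \<Rightarrow> (R3 \<Rightarrow> R3) \<Rightarrow> R3 \<Rightarrow> real" where
  "alpha23 h T V W p = h p (lc_cov h V T p) (W p)"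

text \<open>The (v,w) part of a coordinate triple (t,v,w).\<close>
definition vw :: "real^3 \<Rightarrow> real^2" where
  "vw q = vector [q $ 2, q $ 3]"

end

theory Submission
  imports Defs
begin

text \<open>With vanishing shape operator the affine normal is constant along the hypersurface and the
  induced connection \<open>\<nabla>\<close> is flat. Written in the frame \<open>T, V, W\<close>, flatness of
  \<open>\<nabla> = lc + K\<close> (Gauss and Codazzi together) forces \<open>T\<close> to be geodesic and
  \<open>X \<mapsto> lc_X T\<close> to act on \<open>V, W\<close> as multiplication by \<open>z = \<alpha>22 + i \<alpha>23\<close>, where
  \<open>T z = - z^2\<close> and \<open>(V + i W) z = 0\<close>. Hence \<open>\<zeta> = 1 / z = t + i \<eta>\<close> satisfies
  \<open>T \<zeta> = 1\<close>, so its real part is the first coordinate and \<open>\<eta>\<close> is constant along \<open>T\<close>.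
  Multiplying the coframe \<open>\<theta>_V + i \<theta>_W\<close> by \<open>\<zeta> powr (-2/3) a6 powr (1/3)\<close> makes it closed; a
  primitive \<open>v + i w\<close> supplies the other two coordinates. The frame derivatives of functions of
  \<open>(v, w)\<close> then express the Euclidean Laplacian, and the two equations are the
  Cauchy-Riemann relation for \<open>\<zeta>\<close> and the last Gauss equation.\<close>

subsection \<open>Smooth functions on open subsets of Euclidean space\<close>

text \<open>With respect to \<open>h\<close> the curvature of \<open>\<nabla>\<close> splits into a
  skew part (Gauss) and a self-adjoint part (Codazzi). The second is linear in a_6 and its first
  derivatives; as a_6 > 0 it forces linear relations between the connection coefficients, among them
  that V, W rotate along T at the rate b/3, where b = \<alpha>23 and a = \<alpha>22. This third is
  behind the fractional exponents: [T, .] acts on V, W, modulo T, as multiplication by -(a + 2ib/3),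
  and a factor with that logarithmic T-derivative has to be built from T ln \<zeta> = a + ib and T
  ln a_6 = -a. The obstacle is that [V, W] has T-component 2b, so the planes orthogonal to T are not
  integrable where b is nonzero and no orthogonal surface can carry v, w. They live instead on the
  local quotient by the flow of T, where k = ln (a_6 |\<zeta>|) also descends since its T-derivative
  is -a + a. The second-order operator VV + WW, applied to a function of (v, w), is |f|^2 times the
  Laplacian up to rotation terms, f being the integrating factor; |f|^2 = e^(2k/3) |z|^2 is the
  source of the factor e^(-2k/3) in both equations.\<close>

lemma has_derivative_dd:
  "f differentiable at x \<Longrightarrow> (f has_derivative dd f x) (at x)"
  by (simp add: dd_def[abs_def] frechet_derivative_works[symmetric])

lemma dd_eqI: "(f has_derivative f') (at x) \<Longrightarrow> dd f x u = f' u"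
  unfolding dd_def by (metis frechet_derivative_at)

lemma linear_dd: "f differentiable at x \<Longrightarrow> linear (dd f x)"
  using has_derivative_dd has_derivative_linear by blast

lemma pd_eq_dd: "pd i f x = dd f x (axis i 1)"
  by (simp add: pd_def dd_def)

lemma pd_eqI: "(f has_derivative f') (at x) \<Longrightarrow> pd i f x = f' (axis i 1)"
  by (simp add: pd_eq_dd dd_eqI)

lemma linear_axis_expand:
  assumes "linear (f :: real^'n \<Rightarrow> 'b::real_vector)"
  shows "f u = (\<Sum>i\<in>UNIV. u $ i *\<^sub>R f (axis i 1))"
proof -
  have "f u = f (\<Sum>i\<in>UNIV. u $ i *\<^sub>R axis i 1)"
    by (subst basis_expansion[symmetric, of u]) (simp add: scalar_mult_eq_scaleR)
  then show ?thesis
    by (simp add: linear_sum[OF assms] linear_cmul[OF assms])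
qed

lemma dd_expand:
  fixes f :: "real^'n \<Rightarrow> 'b::real_normed_vector"
  assumes "f differentiable at x"
  shows "dd f x u = (\<Sum>i\<in>UNIV. u $ i *\<^sub>R pd i f x)"
  unfolding pd_eq_dd by (rule linear_axis_expand[OF linear_dd[OF assms]])

lemma has_derivative_pd:
  fixes f :: "real^'n \<Rightarrow> 'b::real_normed_vector"
  assumes "f differentiable at x"
  shows "(f has_derivative (\<lambda>u. \<Sum>i\<in>UNIV. u $ i *\<^sub>R pd i f x)) (at x)"
  using has_derivative_dd[OF assms] by (simp add: dd_expand[OF assms, abs_def])

lemma has_derivative_cong_open:
  assumes "open U" "x \<in> U" "\<And>y. y \<in> U \<Longrightarrow> f y = g y"
  shows "(f has_derivative f') (at x) \<longleftrightarrow> (g has_derivative f') (at x)"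
  using has_derivative_transform_within_open[OF _ assms(1,2), of f f' UNIV g]
      has_derivative_transform_within_open[OF _ assms(1,2), of g f' UNIV f] assms(3) by auto

text \<open>\<open>frechet_derivative\<close> is a choice made from the predicate
  \<open>has_derivative\<close>, which depends only on the germ of the function; so the equality
  holds also at points without a derivative.\<close>

lemma dd_cong:
  assumes "open U" "x \<in> U" "\<And>y. y \<in> U \<Longrightarrow> f y = g y"
  shows "dd f x = dd g x"
  unfolding dd_def frechet_derivative_def
  by (intro ext) (simp add: has_derivative_cong_open[of U x f g, OF assms])

lemma differentiable_on_cong_open:
  assumes "open U" "\<And>y. y \<in> U \<Longrightarrow> f y = g y"
  shows "f differentiable_on U \<longleftrightarrow> g differentiable_on U"
  unfolding differentiable_on_eq_differentiable_at[OF assms(1)] differentiable_def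
  using has_derivative_cong_open[of U _ f g, OF assms(1) _ assms(2)] by simp

text \<open>\<open>iter_pd\<close> adds derivatives on the outside; here the innermost one is peeled
  off first, so that closure proofs go by induction on the order with the function generalised.
  Order 0 already means differentiable.\<close>

fun Ck :: "nat \<Rightarrow> (real^'n) set \<Rightarrow> (real^'n \<Rightarrow> 'b::real_normed_vector) \<Rightarrow> bool" where
  "Ck 0 U f \<longleftrightarrow> f differentiable_on U"
| "Ck (Suc n) U f \<longleftrightarrow> f differentiable_on U \<and> (\<forall>i. Ck n U (pd i f))"

lemma iter_pd_snoc: "iter_pd (is @ [i]) f = iter_pd is (pd i f)"
  by (induction "is") auto

lemma Cinf_iff_pd: "Cinf U f \<longleftrightarrow> f differentiable_on U \<and> (\<forall>i. Cinf U (pd i f))"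
proof (intro iffI conjI allI)
  assume *: "Cinf U f"
  show "f differentiable_on U"
    using *[unfolded Cinf_def, rule_format, of "[]"] by simp
  show "Cinf U (pd i f)" for i
    unfolding Cinf_def
  proof
    fix "is"
    show "iter_pd is (pd i f) differentiable_on U"
      using *[unfolded Cinf_def, rule_format, of "is @ [i]"] by (simp only: iter_pd_snoc)
  qed
next
  assume *: "f differentiable_on U \<and> (\<forall>i. Cinf U (pd i f))"
  show "Cinf U f"
    unfolding Cinf_def
  proof
    fix "is"
    show "iter_pd is f differentiable_on U"
    proof (cases "is" rule: rev_cases)
      case Nil
      then show ?thesis using * by simp
    next
      case (snoc js j)
      then show ?thesis using * by (simp only: iter_pd_snoc Cinf_def)
    qed
  qed
qed

lemma Cinf_imp_Ck: "Cinf U f \<Longrightarrow> Ck n U f"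
proof (induction n arbitrary: f)
  case 0
  then show ?case using Cinf_iff_pd[of U f] by simp
next
  case (Suc n)
  then show ?case using Cinf_iff_pd[of U f] by simp
qed

lemma Ck_imp_iter_pd: "Ck (length is) U f \<Longrightarrow> iter_pd is f differentiable_on U"
proof (induction "is" arbitrary: f rule: rev_induct)
  case Nil
  then show ?case by simp
next
  case (snoc i "is")
  then show ?case by (simp add: iter_pd_snoc)
qed

lemma Cinf_iff_Ck: "Cinf U f \<longleftrightarrow> (\<forall>n. Ck n U f)"
  using Cinf_imp_Ck[of U f] Ck_imp_iter_pd[of _ U f] Cinf_def[of U f] by blast

lemma CinfI: "(\<And>n. Ck n U f) \<Longrightarrow> Cinf U f"
  by (simp add: Cinf_iff_Ck)

lemma Ck_imp_differentiable: "Ck n U f \<Longrightarrow> f differentiable_on U"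
  by (cases n) auto

lemma Ck_differentiable_at: "Ck n U f \<Longrightarrow> open U \<Longrightarrow> x \<in> U \<Longrightarrow> f differentiable at x"
  using Ck_imp_differentiable differentiable_on_eq_differentiable_at by blast

lemma Cinf_differentiable_at: "Cinf U f \<Longrightarrow> open U \<Longrightarrow> x \<in> U \<Longrightarrow> f differentiable at x"
  by (rule Ck_differentiable_at[OF Cinf_imp_Ck[of U f 0]])

lemma Cinf_pd: "Cinf U f \<Longrightarrow> Cinf U (pd i f)"
  by (rule Cinf_iff_pd[THEN iffD1, THEN conjunct2, THEN spec])

lemma Cinf_continuous_on: "Cinf U f \<Longrightarrow> continuous_on U f"
  by (rule differentiable_imp_continuous_on[OF Cinf_iff_pd[THEN iffD1, THEN conjunct1]])

lemma Ck_SucD: "Ck (Suc n) U f \<Longrightarrow> Ck n U f"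
proof (induction n arbitrary: f)
  case 0
  then show ?case by simp
next
  case (Suc n)
  note * = Ck.simps(2)[THEN iffD1, OF Suc.prems]
  show ?case
  proof (rule Ck.simps(2)[THEN iffD2], intro conjI allI)
    show "f differentiable_on U" using * by (rule conjunct1)
    show "Ck n U (pd i f)" for i
      by (rule Suc.IH) (rule *[THEN conjunct2, THEN spec])
  qed
qed

lemma Ck_subset: "Ck n U f \<Longrightarrow> V \<subseteq> U \<Longrightarrow> Ck n V f"
proof (induction n arbitrary: f)
  case 0
  then show ?case using differentiable_on_subset by (simp only: Ck.simps)
next
  case (Suc n)
  then have "f differentiable_on V"
    using differentiable_on_subset Ck_imp_differentiable by blast
  moreover have "Ck n V (pd i f)" for i
    using Suc.prems by (intro Suc.IH) simp_all
  ultimately show ?case by simp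
qed

lemma Cinf_subset: "Cinf U f \<Longrightarrow> V \<subseteq> U \<Longrightarrow> Cinf V f"
  by (rule CinfI) (rule Ck_subset[OF Cinf_imp_Ck])

lemma Ck_cong_imp:
  assumes "open U" "\<And>x. x \<in> U \<Longrightarrow> f x = g x" "Ck n U f"
  shows "Ck n U g"
  using assms(2,3)
proof (induction n arbitrary: f g)
  case 0
  then show ?case
    using differentiable_on_cong_open[OF assms(1), of f g] by simp
next
  case (Suc n)
  have "g differentiable_on U"
    using differentiable_on_cong_open[OF assms(1), of f g] Suc.prems by simp
  moreover have "Ck n U (pd i g)" for i
  proof (rule Suc.IH)
    show "Ck n U (pd i f)" using Suc.prems by simp
    fix x assume "x \<in> U"
    from dd_cong[OF assms(1) this Suc.prems(1)]
    show "pd i f x = pd i g x"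
      unfolding pd_eq_dd by simp
  qed
  ultimately show ?case by simp
qed

lemma Cinf_cong_imp:
  assumes "open U" "\<And>x. x \<in> U \<Longrightarrow> f x = g x" "Cinf U f"
  shows "Cinf U g"
  using Ck_cong_imp[OF assms(1,2)] assms(3) by (simp add: Cinf_iff_Ck)

text \<open>An explicit derivative formula raises the order by one; the closure rules below rest on
  this.\<close>

lemma Ck_SucI:
  assumes "open U"
    and "\<And>x. x \<in> U \<Longrightarrow> (f has_derivative f' x) (at x)"
    and "\<And>i. Ck n U (\<lambda>x. f' x (axis i 1))"
  shows "Ck (Suc n) U f"
proof -
  have "f differentiable_on U"
    unfolding differentiable_on_def differentiable_def using assms(2) has_derivative_at_withinI by blast
  moreover have "Ck n U (pd i f)" for i
    by (rule Ck_cong_imp[OF assms(1) _ assms(3)[of i]]) (simp add: pd_eqI[OF assms(2)])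
  ultimately show ?thesis by simp
qed

lemma Cinf_derivI:
  assumes "open U"
    and "\<And>x. x \<in> U \<Longrightarrow> (f has_derivative f' x) (at x)"
    and "\<And>i. Cinf U (\<lambda>x. f' x (axis i 1))"
  shows "Cinf U f"
proof (rule CinfI)
  fix n
  have "Ck (Suc n) U f"
    by (rule Ck_SucI[OF assms(1,2)]) (use assms(3) Cinf_imp_Ck in auto)
  then show "Ck n U f" by (rule Ck_SucD)
qed

section \<open>Closure properties of smooth functions\<close>

lemma Ck_const: "Ck n U (\<lambda>x. c)"
proof (induction n arbitrary: c)
  case (Suc n)
  have "pd i (\<lambda>x. c) = (\<lambda>x. 0)" for i :: 'a
    by (rule ext) (simp add: pd_def)
  then show ?case using Suc by simp
qed simp

lemma Cinf_const [intro, simp]: "Cinf U (\<lambda>x. c)"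
  by (simp add: Cinf_iff_Ck Ck_const)

lemma Ck_bounded_linear:
  assumes "bounded_linear L" "open U" "Ck n U f"
  shows "Ck n U (\<lambda>x. L (f x))"
  using assms(3)
proof (induction n arbitrary: f)
  case 0
  then have "((\<lambda>x. L (f x)) has_derivative (\<lambda>u. L (dd f x u))) (at x)" if "x \<in> U" for x
    using that assms(2) by (intro bounded_linear.has_derivative[OF assms(1)] has_derivative_dd Ck_differentiable_at)
  then show ?case
    using differentiableI by (fastforce simp: differentiable_on_eq_differentiable_at[OF assms(2)])
next
  case (Suc n)
  show ?case
  proof (rule Ck_SucI[OF assms(2)])
    fix x assume "x \<in> U"
    then show "((\<lambda>x. L (f x)) has_derivative (\<lambda>u. L (dd f x u))) (at x)"
      using Suc.prems assms(2) by (intro bounded_linear.has_derivative[OF assms(1)] has_derivative_dd Ck_differentiable_at)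
  next
    fix i show "Ck n U (\<lambda>x. L (dd f x (axis i 1)))"
      using Suc by (simp flip: pd_eq_dd)
  qed
qed

lemma Ck_add:
  assumes "open U" "Ck n U f" "Ck n U g"
  shows "Ck n U (\<lambda>x. f x + g x)"
  using assms(2,3)
proof (induction n arbitrary: f g)
  case 0
  then show ?case by (auto simp: differentiable_on_def intro: differentiable_add)
next
  case (Suc n)
  show ?case
  proof (rule Ck_SucI[OF assms(1)])
    fix x assume "x \<in> U"
    then show "((\<lambda>x. f x + g x) has_derivative (\<lambda>u. dd f x u + dd g x u)) (at x)"
      using Suc.prems assms(1) by (intro has_derivative_add has_derivative_dd Ck_differentiable_at)
  next
    fix i show "Ck n U (\<lambda>x. dd f x (axis i 1) + dd g x (axis i 1))"
      using Suc by (simp flip: pd_eq_dd)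
  qed
qed

lemma Ck_bilinear:
  assumes "bounded_bilinear B" "open U" "Ck n U f" "Ck n U g"
  shows "Ck n U (\<lambda>x. B (f x) (g x))"
  using assms(3,4)
proof (induction n arbitrary: f g)
  case 0
  then have "((\<lambda>x. B (f x) (g x)) has_derivative (\<lambda>u. B (f x) (dd g x u) + B (dd f x u) (g x))) (at x)"
    if "x \<in> U" for x
    using that assms(2) by (intro bounded_bilinear.FDERIV[OF assms(1)] has_derivative_dd Ck_differentiable_at)
  then show ?case
    using differentiableI by (fastforce simp: differentiable_on_eq_differentiable_at[OF assms(2)])
next
  case (Suc n)
  show ?case
  proof (rule Ck_SucI[OF assms(2)])
    fix x assume "x \<in> U"
    then show "((\<lambda>x. B (f x) (g x)) has_derivative (\<lambda>u. B (f x) (dd g x u) + B (dd f x u) (g x))) (at x)"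
      using Suc.prems assms(2) by (intro bounded_bilinear.FDERIV[OF assms(1)] has_derivative_dd Ck_differentiable_at)
  next
    fix i show "Ck n U (\<lambda>x. B (f x) (dd g x (axis i 1)) + B (dd f x (axis i 1)) (g x))"
      unfolding pd_eq_dd[symmetric]
      using Suc.prems Ck_SucD[OF Suc.prems(1)] Ck_SucD[OF Suc.prems(2)]
      by (intro Ck_add assms(2) Suc.IH) auto
  qed
qed

lemma Ck_sum:
  assumes "open U" "\<And>i. i \<in> I \<Longrightarrow> Ck n U (f i)"
  shows "Ck n U (\<lambda>x. \<Sum>i\<in>I. f i x)"
  using assms(2) by (induction I rule: infinite_finite_induct) (auto intro!: Ck_add Ck_const assms(1))

text \<open>The chain rule replaces \<open>g\<close> by its partial derivatives composed with
  \<open>f\<close>, so the induction runs over all smooth \<open>g\<close> at once while only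
  \<open>f\<close> loses an order.\<close>

lemma Ck_compose:
  fixes f :: "real^'m \<Rightarrow> real^'n"
  assumes "open U" "open V" "Ck n U f" "Cinf V g" "f ` U \<subseteq> V"
  shows "Ck n U (\<lambda>x. g (f x))"
  using assms(3,4)
proof (induction n arbitrary: g)
  case 0
  have "(\<lambda>x. g (f x)) differentiable at x" if "x \<in> U" for x
  proof -
    have "f differentiable at x" using 0 that assms Ck_differentiable_at by blast
    moreover have "g differentiable at (f x)"
      using 0 that assms by (intro Cinf_differentiable_at[of V]) auto
    ultimately show ?thesis
      using differentiable_chain_at[of f x g] by (simp add: o_def)
  qed
  then show ?case using assms(1) by (simp add: differentiable_on_eq_differentiable_at)
next
  case (Suc n)
  show ?case
  proof (rule Ck_SucI[OF assms(1)])
    fix x assume x: "x \<in> U"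
    have "(g has_derivative (\<lambda>u. \<Sum>j\<in>UNIV. u $ j *\<^sub>R pd j g (f x))) (at (f x))"
      using Suc.prems x assms by (intro has_derivative_pd Cinf_differentiable_at[of V]) auto
    moreover have "(f has_derivative dd f x) (at x)"
      using Suc.prems x assms by (intro has_derivative_dd Ck_differentiable_at)
    ultimately show "((\<lambda>x. g (f x)) has_derivative
        (\<lambda>u. \<Sum>j\<in>UNIV. dd f x u $ j *\<^sub>R pd j g (f x))) (at x)"
      using has_derivative_compose by fastforce
  next
    fix i
    have "Ck n U (\<lambda>x. pd j g (f x))" for j
      by (rule Suc.IH[OF Ck_SucD[OF Suc.prems(1)] Cinf_pd[OF Suc.prems(2)]])
    moreover have "Ck n U (\<lambda>x. pd i f x $ j)" for j
      using Suc.prems by (intro Ck_bounded_linear[OF bounded_linear_vec_nth assms(1)]) simp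
    ultimately show "Ck n U (\<lambda>x. \<Sum>j\<in>UNIV. dd f x (axis i 1) $ j *\<^sub>R pd j g (f x))"
      unfolding pd_eq_dd[symmetric]
      by (intro Ck_sum assms(1) Ck_bilinear[OF bounded_bilinear_scaleR])
  qed
qed

lemma Cinf_compose:
  fixes f :: "real^'m \<Rightarrow> real^'n"
  assumes "open U" "open V" "Cinf U f" "Cinf V g" "f ` U \<subseteq> V"
  shows "Cinf U (\<lambda>x. g (f x))"
  by (rule CinfI) (rule Ck_compose[OF assms(1,2) Cinf_imp_Ck[OF assms(3)] assms(4,5)])

lemma Cinf_bounded_linear:
  "bounded_linear L \<Longrightarrow> open U \<Longrightarrow> Cinf U f \<Longrightarrow> Cinf U (\<lambda>x. L (f x))"
  by (rule CinfI) (rule Ck_bounded_linear[OF _ _ Cinf_imp_Ck])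

lemma Cinf_bilinear:
  "bounded_bilinear B \<Longrightarrow> open U \<Longrightarrow> Cinf U f \<Longrightarrow> Cinf U g \<Longrightarrow> Cinf U (\<lambda>x. B (f x) (g x))"
  by (rule CinfI) (rule Ck_bilinear[OF _ _ Cinf_imp_Ck Cinf_imp_Ck])

lemma Cinf_add: "open U \<Longrightarrow> Cinf U f \<Longrightarrow> Cinf U g \<Longrightarrow> Cinf U (\<lambda>x. f x + g x)"
  by (rule CinfI) (rule Ck_add[OF _ Cinf_imp_Ck Cinf_imp_Ck])

lemma Cinf_sum: "open U \<Longrightarrow> (\<And>i. i \<in> I \<Longrightarrow> Cinf U (f i)) \<Longrightarrow> Cinf U (\<lambda>x. \<Sum>i\<in>I. f i x)"
  by (rule CinfI) (rule Ck_sum[OF _ Cinf_imp_Ck])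

lemma Cinf_minus: "open U \<Longrightarrow> Cinf U f \<Longrightarrow> Cinf U (\<lambda>x. - f x)"
  by (rule Cinf_bounded_linear[OF bounded_linear_minus[OF bounded_linear_ident]])

lemma Cinf_diff: "open U \<Longrightarrow> Cinf U f \<Longrightarrow> Cinf U g \<Longrightarrow> Cinf U (\<lambda>x. f x - g x)"
  using Cinf_add[of U f "\<lambda>x. - g x"] Cinf_minus[of U g] by simp

lemma Cinf_scaleR: "open U \<Longrightarrow> Cinf U f \<Longrightarrow> Cinf U g \<Longrightarrow> Cinf U (\<lambda>x. f x *\<^sub>R g x)"
  by (rule Cinf_bilinear[OF bounded_bilinear_scaleR])

lemma Cinf_mult:
  fixes f g :: "real^'n \<Rightarrow> 'b::real_normed_algebra"
  shows "open U \<Longrightarrow> Cinf U f \<Longrightarrow> Cinf U g \<Longrightarrow> Cinf U (\<lambda>x. f x * g x)"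
  by (rule Cinf_bilinear[OF bounded_bilinear_mult])

lemma Cinf_prod:
  fixes f :: "'i \<Rightarrow> real^'n \<Rightarrow> 'b::real_normed_field"
  assumes "open U" "\<And>i. i \<in> I \<Longrightarrow> Cinf U (f i)"
  shows "Cinf U (\<lambda>x. \<Prod>i\<in>I. f i x)"
  using assms(2) by (induction I rule: infinite_finite_induct) (auto intro!: Cinf_mult assms(1))

lemma Cinf_vec_nth: "open U \<Longrightarrow> Cinf U f \<Longrightarrow> Cinf U (\<lambda>x. f x $ i)"
  by (rule Cinf_bounded_linear[OF bounded_linear_vec_nth])

lemma Cinf_ident: "open U \<Longrightarrow> Cinf U (\<lambda>x. x)"
  by (rule Cinf_derivI[where f' = "\<lambda>x u. u"]) auto

lemma Cinf_vecI:
  fixes f :: "real^'n \<Rightarrow> real^'m"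
  assumes "open U" "\<And>i. Cinf U (\<lambda>x. f x $ i)"
  shows "Cinf U f"
proof -
  have "Cinf U (\<lambda>x. \<Sum>i\<in>UNIV. f x $ i *\<^sub>R (axis i 1 :: real^'m))"
    by (intro Cinf_sum Cinf_scaleR assms Cinf_const)
  moreover have "(\<Sum>i\<in>UNIV. f x $ i *\<^sub>R (axis i 1 :: real^'m)) = f x" for x
    using basis_expansion[of "f x"] by (simp add: scalar_mult_eq_scaleR)
  ultimately show ?thesis by (simp)
qed

lemma Cinf_inverse:
  fixes f :: "real^'n \<Rightarrow> 'b::real_normed_field"
  assumes "open U" "Cinf U f" "\<And>x. x \<in> U \<Longrightarrow> f x \<noteq> 0"
  shows "Cinf U (\<lambda>x. inverse (f x))"
proof -
  have d: "((\<lambda>x. inverse (f x)) has_derivative (\<lambda>u. - (inverse (f x) * dd f x u * inverse (f x)))) (at x)"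
    if "x \<in> U" for x
    using that assms by (intro Deriv.has_derivative_inverse has_derivative_dd Cinf_differentiable_at)
  \<comment> \<open>The derivative contains the function itself, so \<open>Cinf_derivI\<close> would
    be circular; regularity is gained one order at a time.\<close>
  have "Ck n U (\<lambda>x. inverse (f x))" for n
  proof (induction n)
    case 0
    show ?case
      using d by (auto simp: differentiable_on_def differentiable_def intro: has_derivative_at_withinI)
  next
    case (Suc n)
    show ?case
    proof (rule Ck_SucI[OF assms(1) d])
      fix i
      have "Ck n U (pd i f)" by (rule Cinf_imp_Ck[OF Cinf_pd[OF assms(2)]])
      then show "Ck n U (\<lambda>x. - (inverse (f x) * dd f x (axis i 1) * inverse (f x)))"
        unfolding pd_eq_dd[symmetric] using Suc
        by (intro Ck_bounded_linear[OF bounded_linear_minus[OF bounded_linear_ident]]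
            Ck_bilinear[OF bounded_bilinear_mult] assms(1))
    qed
  qed
  then show ?thesis by (rule CinfI)
qed

lemma Cinf_divide:
  fixes f g :: "real^'n \<Rightarrow> 'b::real_normed_field"
  assumes "open U" "Cinf U f" "Cinf U g" "\<And>x. x \<in> U \<Longrightarrow> g x \<noteq> 0"
  shows "Cinf U (\<lambda>x. f x / g x)"
  unfolding divide_inverse using assms by (intro Cinf_mult Cinf_inverse)

lemma Cinf_exp:
  fixes f :: "real^'n \<Rightarrow> 'b::{real_normed_field,banach}"
  assumes "open U" "Cinf U f"
  shows "Cinf U (\<lambda>x. exp (f x))"
proof -
  have d: "((\<lambda>x. exp (f x)) has_derivative (\<lambda>u. exp (f x) * dd f x u)) (at x)" if "x \<in> U" for x
    using has_derivative_compose[OF has_derivative_dd DERIV_exp[unfolded has_field_derivative_def]]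
      Cinf_differentiable_at[OF assms(2,1) that] by blast
  have "Ck n U (\<lambda>x. exp (f x))" for n
  proof (induction n)
    case 0
    show ?case
      using d by (auto simp: differentiable_on_def differentiable_def intro: has_derivative_at_withinI)
  next
    case (Suc n)
    show ?case
    proof (rule Ck_SucI[OF assms(1) d])
      fix i
      have "Ck n U (pd i f)" by (rule Cinf_imp_Ck[OF Cinf_pd[OF assms(2)]])
      then show "Ck n U (\<lambda>x. exp (f x) * dd f x (axis i 1))"
        unfolding pd_eq_dd[symmetric] using Suc
        by (intro Ck_bilinear[OF bounded_bilinear_mult] assms(1))
    qed
  qed
  then show ?thesis by (rule CinfI)
qed

lemma Cinf_ln:
  fixes f :: "real^'n \<Rightarrow> real"
  assumes "open U" "Cinf U f" "\<And>x. x \<in> U \<Longrightarrow> f x > 0"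
  shows "Cinf U (\<lambda>x. ln (f x))"
proof (rule Cinf_derivI[OF assms(1)])
  show "((\<lambda>x. ln (f x)) has_derivative (\<lambda>u. dd f x u / f x)) (at x)" if "x \<in> U" for x
    using has_derivative_compose[OF has_derivative_dd DERIV_ln_divide[unfolded has_field_derivative_def]]
      Cinf_differentiable_at[OF assms(2,1) that] assms(3)[OF that] by force
  show "Cinf U (\<lambda>x. dd f x (axis i 1) / f x)" for i
    unfolding pd_eq_dd[symmetric] using assms by (intro Cinf_divide Cinf_pd) force+
qed

lemma has_derivative_Ln:
  assumes "(f has_derivative f') (at x)" "f x \<notin> \<real>\<^sub>\<le>\<^sub>0"
  shows "((\<lambda>x. Ln (f x)) has_derivative (\<lambda>u. f' u / f x)) (at x)"
  using has_derivative_compose[OF assms(1) has_field_derivative_Ln[OF assms(2), unfolded has_field_derivative_def]]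
  by (simp add: field_simps)

lemma Cinf_Ln:
  fixes f :: "real^'n \<Rightarrow> complex"
  assumes "open U" "Cinf U f" "\<And>x. x \<in> U \<Longrightarrow> f x \<notin> \<real>\<^sub>\<le>\<^sub>0"
  shows "Cinf U (\<lambda>x. Ln (f x))"
proof (rule Cinf_derivI[OF assms(1)])
  show "((\<lambda>x. Ln (f x)) has_derivative (\<lambda>u. dd f x u / f x)) (at x)" if "x \<in> U" for x
    using that assms by (intro has_derivative_Ln has_derivative_dd Cinf_differentiable_at)
  show "Cinf U (\<lambda>x. dd f x (axis i 1) / f x)" for i
    unfolding pd_eq_dd[symmetric] using assms by (intro Cinf_divide Cinf_pd) force+
qed

lemma Cinf_dd:
  fixes f :: "real^'n \<Rightarrow> 'b::real_normed_vector"
  assumes "open U" "Cinf U f" "Cinf U X"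
  shows "Cinf U (\<lambda>x. dd f x (X x))"
proof -
  have "Cinf U (\<lambda>x. \<Sum>i\<in>UNIV. X x $ i *\<^sub>R pd i f x)"
    by (intro Cinf_sum Cinf_scaleR Cinf_vec_nth Cinf_pd assms)
  moreover have "(\<Sum>i\<in>UNIV. X x $ i *\<^sub>R pd i f x) = dd f x (X x)" if "x \<in> U" for x
    by (rule dd_expand[symmetric]) (rule Cinf_differentiable_at[OF assms(2,1) that])
  ultimately show ?thesis
    by (rule Cinf_cong_imp[OF assms(1), rotated])
qed

lemma Cinf_det:
  fixes A :: "real^'n \<Rightarrow> real^'m^'m"
  assumes "open U" "\<And>i j. Cinf U (\<lambda>x. A x $ i $ j)"
  shows "Cinf U (\<lambda>x. det (A x))"
  unfolding det_def by (intro Cinf_sum Cinf_mult Cinf_prod Cinf_const assms)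

text \<open>Cramer's rule writes each component of the solution as a quotient of determinants in the
  smooth data. It serves where an object is given only implicitly: \<open>h\<close> and
  \<open>\<Gamma>\<close> in the Gauss formula, and the inverse of a differential.\<close>

lemma Cinf_linear_solve:
  fixes A :: "real^'n \<Rightarrow> real^'m^'m" and x b :: "real^'n \<Rightarrow> real^'m"
  assumes U: "open U" and A: "\<And>i j. Cinf U (\<lambda>p. A p $ i $ j)" and b: "Cinf U b"
    and det: "\<And>p. p \<in> U \<Longrightarrow> det (A p) \<noteq> 0"
    and eq: "\<And>p. p \<in> U \<Longrightarrow> A p *v x p = b p"
  shows "Cinf U x"
proof (rule Cinf_vecI[OF U])
  fix k
  let ?M = "\<lambda>p. \<chi> i j. if j = k then b p $ i else A p $ i $ j"
  have M: "Cinf U (\<lambda>p. ?M p $ i $ j)" for i j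
    using Cinf_vec_nth[OF U b, of i] A[of i j] by (cases "j = k") simp_all
  show "Cinf U (\<lambda>p. x p $ k)"
  proof (rule Cinf_cong_imp[OF U])
    show "Cinf U (\<lambda>p. det (?M p) / det (A p))"
      by (rule Cinf_divide[OF U Cinf_det[OF U M] Cinf_det[OF U A] det])
    show "det (?M p) / det (A p) = x p $ k" if "p \<in> U" for p
      using cramer[OF det[OF that], of "x p" "b p"] eq[OF that] by (simp add: vec_eq_iff)
  qed
qed

subsection \<open>Symmetry of second derivatives, closed forms, smooth inverses\<close>

lemma has_vector_derivative_along_line:
  assumes "G differentiable at (a + x *\<^sub>R u)"
  shows "((\<lambda>x. G (a + x *\<^sub>R u)) has_vector_derivative dd G (a + x *\<^sub>R u) u) (at x)"
proof -
  have "((\<lambda>x. a + x *\<^sub>R u) has_derivative (\<lambda>h. h *\<^sub>R u)) (at x)"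
    by (auto intro!: derivative_eq_intros)
  from has_derivative_compose[OF this has_derivative_dd[OF assms]]
  show ?thesis
    unfolding has_vector_derivative_def by (simp add: linear_cmul[OF linear_dd[OF assms]])
qed

text \<open>The left-hand side is symmetric in \<open>u\<close> and \<open>v\<close>, which is what makes mixed derivatives agree.\<close>
lemma second_difference_mvt:
  fixes F :: "real^'n \<Rightarrow> real"
  assumes "Cinf (ball p \<delta>) F" "0 < s" "s * (norm u + norm v) < \<delta>"
  obtains q where "q \<in> ball p \<delta>"
    "F (p + s *\<^sub>R u + s *\<^sub>R v) - F (p + s *\<^sub>R u) - F (p + s *\<^sub>R v) + F p
       = s\<^sup>2 * dd (\<lambda>r. dd F r u) q v"
proof -
  have mem: "p + x *\<^sub>R u + y *\<^sub>R v \<in> ball p \<delta>" if "0 \<le> x" "x \<le> s" "0 \<le> y" "y \<le> s" for x y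
  proof -
    have "norm (x *\<^sub>R u + y *\<^sub>R v) \<le> x * norm u + y * norm v"
      using that by (intro norm_triangle_le) simp
    also have "\<dots> \<le> s * (norm u + norm v)"
      using that by (simp add: distrib_left add_mono mult_right_mono)
    finally show ?thesis using assms(3) by (simp add: dist_norm norm_minus_commute algebra_simps)
  qed
  have d1: "F differentiable at r" if "r \<in> ball p \<delta>" for r
    using Cinf_differentiable_at[OF assms(1) open_ball that] .
  have d2: "(\<lambda>r. dd F r u) differentiable at r" if "r \<in> ball p \<delta>" for r
    using Cinf_differentiable_at[OF Cinf_dd[OF open_ball assms(1) Cinf_const] open_ball that] .
  \<comment> \<open>The second difference is the increment of \<open>?g\<close> over [0, s]. The
    mean value theorem is applied twice, first in direction \<open>u\<close>, then to the resulting
    derivative in direction \<open>v\<close>.\<close>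
  let ?g = "\<lambda>x. F ((p + s *\<^sub>R v) + x *\<^sub>R u) - F (p + x *\<^sub>R u)"
  have "DERIV ?g x :> dd F ((p + s *\<^sub>R v) + x *\<^sub>R u) u - dd F (p + x *\<^sub>R u) u" if "0 \<le> x" "x \<le> s" for x
    unfolding has_real_derivative_iff_has_vector_derivative
    using mem[OF that, of s] mem[OF that, of 0] assms(2)
    by (intro has_vector_derivative_diff has_vector_derivative_along_line d1) (auto simp: algebra_simps)
  from MVT2[OF assms(2) this] obtain x where x: "0 < x" "x < s"
    "?g s - ?g 0 = s * (dd F ((p + s *\<^sub>R v) + x *\<^sub>R u) u - dd F (p + x *\<^sub>R u) u)"
    by auto
  let ?k = "\<lambda>y. dd F ((p + x *\<^sub>R u) + y *\<^sub>R v) u"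
  have "DERIV ?k y :> dd (\<lambda>r. dd F r u) ((p + x *\<^sub>R u) + y *\<^sub>R v) v" if "0 \<le> y" "y \<le> s" for y
    unfolding has_real_derivative_iff_has_vector_derivative
    using mem[of x y] that x(1,2)
    by (intro has_vector_derivative_along_line[where G = "\<lambda>r. dd F r u"] d2) auto
  from MVT2[OF assms(2) this] obtain y where y: "0 < y" "y < s"
    "?k s - ?k 0 = s * dd (\<lambda>r. dd F r u) ((p + x *\<^sub>R u) + y *\<^sub>R v) v"
    by auto
  show ?thesis
  proof (rule that)
    show "p + x *\<^sub>R u + y *\<^sub>R v \<in> ball p \<delta>" using mem x y by simp
    have "F (p + s *\<^sub>R u + s *\<^sub>R v) - F (p + s *\<^sub>R u) - F (p + s *\<^sub>R v) + F p = ?g s - ?g 0"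
      by (simp add: algebra_simps)
    also have "\<dots> = s * (?k s - ?k 0)"
      unfolding x(3) by (simp add: algebra_simps)
    finally show "F (p + s *\<^sub>R u + s *\<^sub>R v) - F (p + s *\<^sub>R u) - F (p + s *\<^sub>R v) + F p
       = s\<^sup>2 * dd (\<lambda>r. dd F r u) (p + x *\<^sub>R u + y *\<^sub>R v) v"
      unfolding y(3) by (simp add: power2_eq_square)
  qed
qed

text \<open>Both mixed derivatives, taken at suitable points near \<open>p\<close>, equal the same
  second difference divided by s^2; their continuity at \<open>p\<close> excludes a gap.\<close>

lemma dd_dd_commute_real:
  fixes F :: "real^'n \<Rightarrow> real"
  assumes "open U" "Cinf U F" "p \<in> U"
  shows "dd (\<lambda>r. dd F r u) p v = dd (\<lambda>r. dd F r v) p u"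
proof (rule ccontr)
  let ?A = "\<lambda>q. dd (\<lambda>r. dd F r u) q v" and ?B = "\<lambda>q. dd (\<lambda>r. dd F r v) q u"
  assume "?A p \<noteq> ?B p"
  define e where "e = dist (?A p) (?B p) / 2"
  have e: "e > 0" using \<open>?A p \<noteq> ?B p\<close> by (simp add: e_def)
  have cont: "isCont (\<lambda>q. dd (\<lambda>r. dd F r a) q b) p" for a b
    by (rule differentiable_imp_continuous_within,
        rule Cinf_differentiable_at[OF Cinf_dd[OF assms(1) Cinf_dd[OF assms(1,2) Cinf_const] Cinf_const] assms(1,3)])
  from cont[of u v] e obtain d1 where d1: "d1 > 0" "\<And>q. dist q p < d1 \<Longrightarrow> dist (?A q) (?A p) < e"
    unfolding continuous_at_eps_delta by metis
  from cont[of v u] e obtain d2 where d2: "d2 > 0" "\<And>q. dist q p < d2 \<Longrightarrow> dist (?B q) (?B p) < e"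
    unfolding continuous_at_eps_delta by metis
  from assms(1,3) obtain d3 where d3: "d3 > 0" "ball p d3 \<subseteq> U"
    using open_contains_ball by blast
  define \<delta> where "\<delta> = min d1 (min d2 d3)"
  have \<delta>: "\<delta> > 0" "\<delta> \<le> d1" "\<delta> \<le> d2" "ball p \<delta> \<subseteq> U"
    using d1 d2 d3 by (auto simp: \<delta>_def)
  \<comment> \<open>Small enough to keep the parallelogram inside the ball; the summand 1 covers u =
    v = 0.\<close>
  define s where "s = \<delta> / (norm u + norm v + 1)"
  have s: "s > 0" "s * (norm u + norm v) < \<delta>"
    using \<delta>(1) by (auto simp: s_def field_simps add_pos_nonneg intro!: divide_pos_pos add_nonneg_pos)
  have C: "Cinf (ball p \<delta>) F" using Cinf_subset assms(2) \<delta>(4) by blast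
  obtain q1 where q1: "q1 \<in> ball p \<delta>"
    "F (p + s *\<^sub>R u + s *\<^sub>R v) - F (p + s *\<^sub>R u) - F (p + s *\<^sub>R v) + F p = s\<^sup>2 * ?A q1"
    using second_difference_mvt[OF C s] .
  obtain q2 where q2: "q2 \<in> ball p \<delta>"
    "F (p + s *\<^sub>R v + s *\<^sub>R u) - F (p + s *\<^sub>R v) - F (p + s *\<^sub>R u) + F p = s\<^sup>2 * ?B q2"
    using second_difference_mvt[OF C s(1), of v u] s(2) by (auto simp: add.commute)
  have "s\<^sup>2 * ?A q1 = s\<^sup>2 * ?B q2"
    unfolding q1(2)[symmetric] q2(2)[symmetric] by (simp add: algebra_simps)
  then have "?A q1 = ?B q2" using s(1) by simp
  moreover have "dist (?A q1) (?A p) < e"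
    by (rule d1(2)) (use q1(1) \<delta> in \<open>simp add: dist_commute\<close>)
  moreover have "dist (?B q2) (?B p) < e"
    by (rule d2(2)) (use q2(1) \<delta> in \<open>simp add: dist_commute\<close>)
  ultimately have "dist (?A p) (?B p) < 2 * e"
    by (simp add: dist_real_def abs_if split: if_splits)
  then show False by (simp add: e_def)
qed

lemma dd_bounded_linear:
  assumes "bounded_linear L" "f differentiable at x"
  shows "dd (\<lambda>r. L (f r)) x u = L (dd f x u)"
  by (rule dd_eqI) (rule bounded_linear.has_derivative[OF assms(1) has_derivative_dd[OF assms(2)]])

lemma dd_dd_commute:
  fixes F :: "real^'n \<Rightarrow> 'b::euclidean_space"
  assumes "open U" "Cinf U F" "p \<in> U"
  shows "dd (\<lambda>r. dd F r u) p v = dd (\<lambda>r. dd F r v) p u"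
proof (rule euclidean_eqI)
  fix b :: 'b assume "b \<in> Basis"
  have *: "dd (\<lambda>r. dd (\<lambda>q. F q \<bullet> b) r u) p v = dd (\<lambda>r. dd F r u) p v \<bullet> b" for u v
  proof -
    have "dd (\<lambda>r. dd (\<lambda>q. F q \<bullet> b) r u) p = dd (\<lambda>r. dd F r u \<bullet> b) p"
      using assms by (intro dd_cong[of U] dd_bounded_linear bounded_linear_inner_left Cinf_differentiable_at)
    moreover have "dd (\<lambda>r. dd F r u \<bullet> b) p v = dd (\<lambda>r. dd F r u) p v \<bullet> b"
      using assms by (intro dd_bounded_linear bounded_linear_inner_left Cinf_differentiable_at[of U] Cinf_dd Cinf_const)
    ultimately show ?thesis by simp
  qed
  have "Cinf U (\<lambda>q. F q \<bullet> b)"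
    using assms by (intro Cinf_bounded_linear[OF bounded_linear_inner_left])
  then show "dd (\<lambda>r. dd F r u) p v \<bullet> b = dd (\<lambda>r. dd F r v) p u \<bullet> b"
    unfolding *[symmetric] using dd_dd_commute_real[OF assms(1) _ assms(3)] by blast
qed

text \<open>Poincare lemma: the form is integrated along the segments from the centre, and the
  integral is differentiated under the integral sign. Closedness turns the differentiated integrand
  into an exact t-derivative, so only its endpoint value remains.\<close>

lemma smooth_closed_form_exact:
  fixes g :: "'n::finite \<Rightarrow> real^'n \<Rightarrow> 'b::euclidean_space"
  assumes smooth: "\<And>i. Cinf (ball c r) (g i)"
    and closed: "\<And>i j p. p \<in> ball c r \<Longrightarrow> pd i (g j) p = pd j (g i) p"
  obtains F where "\<And>p. p \<in> ball c r \<Longrightarrow> (F has_derivative (\<lambda>u. \<Sum>i\<in>UNIV. u $ i *\<^sub>R g i p)) (at p)"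
proof -
  let ?U = "ball c r"
  define \<gamma> where "\<gamma> x t = c + t *\<^sub>R (x - c)" for x :: "real^'n" and t :: real
  have mem: "\<gamma> x t \<in> ?U" if "x \<in> ?U" "t \<in> cbox 0 1" for x t
  proof -
    have "t * norm (x - c) \<le> 1 * norm (x - c)" using that by (intro mult_right_mono) auto
    then show ?thesis using that by (simp add: \<gamma>_def dist_norm norm_minus_commute)
  qed
  have diff: "g i differentiable at p" if "p \<in> ?U" for i p
    using Cinf_differentiable_at[OF smooth open_ball that] .
  \<comment> \<open>The t-derivative of \<open>t *\<^sub>R g j (\<gamma> x t)\<close>, hence with
    integral \<open>g j x\<close> over [0, 1].\<close>
  define W where "W j x t = g j (\<gamma> x t) + t *\<^sub>R dd (g j) (\<gamma> x t) (x - c)" for j x t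
  define f where "f x t = (\<Sum>i\<in>UNIV. (x - c) $ i *\<^sub>R g i (\<gamma> x t))" for x t
  define fx where "fx x t = Blinfun (\<lambda>u. \<Sum>j\<in>UNIV. u $ j *\<^sub>R W j x t)" for x t
  define F where "F x = integral (cbox 0 1) (f x)" for x
  have fx: "blinfun_apply (fx x t) u = (\<Sum>j\<in>UNIV. u $ j *\<^sub>R W j x t)" for x t u
    unfolding fx_def
    by (subst bounded_linear_Blinfun_apply)
      (auto intro!: bounded_linear_sum bounded_linear_compose[OF bounded_linear_scaleR_left bounded_linear_vec_nth])
  \<comment> \<open>The only place where closedness enters: it exchanges the direction of
    differentiation with the argument of the form.\<close>
  have swap: "(\<Sum>i\<in>UNIV. a $ i *\<^sub>R dd (g i) p u) = (\<Sum>j\<in>UNIV. u $ j *\<^sub>R dd (g j) p a)"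
    if "p \<in> ?U" for a u p
    unfolding dd_expand[OF diff[OF that]] scaleR_sum_right
    by (subst sum.swap) (simp add: closed[OF that] mult.commute)
  have deriv: "((\<lambda>x. f x t) has_derivative blinfun_apply (fx x t)) (at x within ?U)"
    if x: "x \<in> ?U" and t: "t \<in> cbox 0 1" for x t
  proof -
    note m = mem[OF x t]
    have "((\<lambda>x. \<gamma> x t) has_derivative (\<lambda>u. t *\<^sub>R u)) (at x)"
      unfolding \<gamma>_def by (auto intro!: derivative_eq_intros)
    from has_derivative_compose[OF this has_derivative_dd[OF diff[OF m]]]
    have g: "((\<lambda>x. g i (\<gamma> x t)) has_derivative (\<lambda>u. dd (g i) (\<gamma> x t) (t *\<^sub>R u))) (at x)" for i .
    have v: "((\<lambda>x. (x - c) $ i) has_derivative (\<lambda>u. u $ i)) (at x)" for i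
      by (auto intro!: derivative_eq_intros bounded_linear.has_derivative[OF bounded_linear_vec_nth])
    have "((\<lambda>x. f x t) has_derivative (\<lambda>u. \<Sum>i\<in>UNIV. (x - c) $ i *\<^sub>R dd (g i) (\<gamma> x t) (t *\<^sub>R u)
            + u $ i *\<^sub>R g i (\<gamma> x t))) (at x)"
      unfolding f_def by (intro has_derivative_sum has_derivative_scaleR v g)
    also have "(\<lambda>u. \<Sum>i\<in>UNIV. (x - c) $ i *\<^sub>R dd (g i) (\<gamma> x t) (t *\<^sub>R u)
            + u $ i *\<^sub>R g i (\<gamma> x t)) = blinfun_apply (fx x t)"
    proof (rule ext)
      fix u
      have "(\<Sum>i\<in>UNIV. (x - c) $ i *\<^sub>R dd (g i) (\<gamma> x t) (t *\<^sub>R u))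
          = (\<Sum>j\<in>UNIV. u $ j *\<^sub>R t *\<^sub>R dd (g j) (\<gamma> x t) (x - c))"
        by (subst swap[OF m]) (simp add: mult.commute)
      then show "(\<Sum>i\<in>UNIV. (x - c) $ i *\<^sub>R dd (g i) (\<gamma> x t) (t *\<^sub>R u)
            + u $ i *\<^sub>R g i (\<gamma> x t)) = blinfun_apply (fx x t) u"
        by (simp add: fx W_def sum.distrib scaleR_add_right)
    qed
    finally show ?thesis by (rule has_derivative_at_withinI)
  qed
  have cont_\<gamma>: "continuous_on (?U \<times> cbox 0 1) (\<lambda>z. \<gamma> (fst z) (snd z))"
    unfolding \<gamma>_def by (intro continuous_intros)
  have cont_comp: "continuous_on (?U \<times> cbox 0 1) (\<lambda>z. G (\<gamma> (fst z) (snd z)))"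
    if "continuous_on ?U G" for G :: "real^'n \<Rightarrow> 'b"
    by (rule continuous_on_compose2[OF that cont_\<gamma>]) (use mem in auto)
  have cont_W: "continuous_on (?U \<times> cbox 0 1) (\<lambda>z. W j (fst z) (snd z))" for j
  proof -
    have "continuous_on (?U \<times> cbox 0 1) (\<lambda>z. g j (\<gamma> (fst z) (snd z))
        + snd z *\<^sub>R (\<Sum>i\<in>UNIV. (fst z - c) $ i *\<^sub>R pd i (g j) (\<gamma> (fst z) (snd z))))"
      by (intro continuous_intros cont_comp Cinf_continuous_on Cinf_pd smooth)
    moreover have "W j (fst z) (snd z) = g j (\<gamma> (fst z) (snd z))
        + snd z *\<^sub>R (\<Sum>i\<in>UNIV. (fst z - c) $ i *\<^sub>R pd i (g j) (\<gamma> (fst z) (snd z)))"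
      if "z \<in> ?U \<times> cbox 0 1" for z
      using that unfolding W_def by (subst dd_expand[OF diff[OF mem]]) auto
    ultimately show ?thesis
      by (simp cong: continuous_on_cong)
  qed
  have cont_t: "continuous_on (cbox 0 1) (\<lambda>t. W j x t)" if "x \<in> ?U" for j x
    by (rule continuous_on_compose2[OF cont_W[of j], of _ "\<lambda>t. (x, t)", simplified])
      (use that in \<open>auto intro!: continuous_intros\<close>)
  have "continuous_on (?U \<times> cbox 0 1) (\<lambda>(x, t). fx x t)"
    unfolding split_beta
    by (rule continuous_on_blinfun_componentwise) (simp only: fx, intro continuous_intros cont_W)
  moreover have "f x integrable_on cbox 0 1" if "x \<in> ?U" for x
  proof (rule integrable_continuous)
    have "continuous_on (cbox 0 1) (\<lambda>t. g i (\<gamma> x t))" for i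
      by (rule continuous_on_compose2[OF Cinf_continuous_on[OF smooth[of i]]])
        (use mem[OF that] in \<open>auto simp: \<gamma>_def intro!: continuous_intros\<close>)
    then show "continuous_on (cbox 0 1) (f x)"
      unfolding f_def by (intro continuous_intros)
  qed
  ultimately have F: "(F has_derivative blinfun_apply (integral (cbox 0 1) (fx x))) (at x within ?U)"
    if "x \<in> ?U" for x
    unfolding F_def[abs_def] by (intro leibniz_rule deriv that convex_ball)
  have "integral (cbox 0 1) (fx x) u = (\<Sum>j\<in>UNIV. u $ j *\<^sub>R g j x)" if x: "x \<in> ?U" for x u
  proof -
    have int: "(W j x has_integral g j x) (cbox 0 1)" for j
    proof -
      have "((\<lambda>t. t *\<^sub>R g j (\<gamma> x t)) has_vector_derivative W j x t) (at t within cbox 0 1)"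
        if "t \<in> cbox 0 1" for t
      proof -
        have "((\<lambda>t. g j (\<gamma> x t)) has_vector_derivative dd (g j) (\<gamma> x t) (x - c)) (at t)"
          unfolding \<gamma>_def
          by (rule has_vector_derivative_along_line) (use diff[OF mem[OF x that]] in \<open>simp add: \<gamma>_def\<close>)
        from has_vector_derivative_scaleR[OF DERIV_ident this]
        show ?thesis
          unfolding W_def by (simp add: has_vector_derivative_at_within add.commute)
      qed
      from fundamental_theorem_of_calculus[OF _ this[unfolded cbox_interval]]
      show ?thesis by (simp add: \<gamma>_def)
    qed
    have "fx x integrable_on cbox 0 1"
      by (intro integrable_continuous continuous_on_blinfun_componentwise)
        (simp only: fx, intro continuous_intros cont_t[OF x])
    then have "integral (cbox 0 1) (fx x) u = integral (cbox 0 1) (\<lambda>t. fx x t u)"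
      by (rule blinfun_apply_integral)
    also have "\<dots> = (\<Sum>j\<in>UNIV. u $ j *\<^sub>R g j x)"
      unfolding fx by (intro integral_unique has_integral_sum has_integral_cmul int) auto
    finally show ?thesis .
  qed
  then have "blinfun_apply (integral (cbox 0 1) (fx p)) = (\<lambda>u. \<Sum>i\<in>UNIV. u $ i *\<^sub>R g i p)"
    if "p \<in> ?U" for p
    using that by blast
  then have "(F has_derivative (\<lambda>u. \<Sum>i\<in>UNIV. u $ i *\<^sub>R g i p)) (at p)" if "p \<in> ?U" for p
    using F[OF that] that by (simp only: at_within_open[OF that open_ball])
  then show ?thesis by (rule that)
qed

lemma matrix_mult_linear:
  fixes f :: "real^'n \<Rightarrow> real^'m"
  assumes "linear f"
  shows "matrix f *v x = f x"
  by (subst linear_axis_expand[OF assms, of x])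
    (simp add: vec_eq_iff matrix_vector_mult_def matrix_def mult.commute)

text \<open>The inverse function theorem supplies a differentiable inverse \<open>g\<close>. Its
  partial derivatives are \<open>Z j\<close> composed with \<open>g\<close>, where
  \<open>Z j\<close> is smooth on the source side; each order of regularity of \<open>g\<close>
  therefore yields the next.\<close>

lemma smooth_inverse_function:
  fixes \<Psi> :: "real^'n \<Rightarrow> real^'n"
  assumes U: "open U" and smooth: "Cinf U \<Psi>" and p: "p \<in> U"
    and inj: "\<And>q u. q \<in> U \<Longrightarrow> dd \<Psi> q u = 0 \<Longrightarrow> u = 0"
  obtains U' V g where "open U'" "U' \<subseteq> U" "p \<in> U'" "open V" "homeomorphism U' V \<Psi> g" "Cinf V g"
proof -
  have diff: "\<Psi> differentiable at q" if "q \<in> U" for q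
    using Cinf_differentiable_at[OF smooth U that] .
  have bl: "bounded_linear (dd \<Psi> q)" if "q \<in> U" for q
    using has_derivative_bounded_linear[OF has_derivative_dd[OF diff[OF that]]] .
  define \<Psi>' where "\<Psi>' q = Blinfun (dd \<Psi> q)" for q
  have \<Psi>': "blinfun_apply (\<Psi>' q) = dd \<Psi> q" if "q \<in> U" for q
    unfolding \<Psi>'_def by (rule bounded_linear_Blinfun_apply[OF bl[OF that]])
  have cont: "continuous_on U \<Psi>'"
  proof (rule continuous_on_blinfun_componentwise)
    fix i :: "real^'n"
    have "continuous_on U (\<lambda>q. dd \<Psi> q i)"
      by (intro Cinf_continuous_on Cinf_dd U smooth Cinf_const)
    then show "continuous_on U (\<lambda>q. blinfun_apply (\<Psi>' q) i)"
      by (simp add: \<Psi>' cong: continuous_on_cong)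
  qed
  have injd: "inj (dd \<Psi> q)" if "q \<in> U" for q
    using linear_injective_0[OF linear_dd[OF diff[OF that]]] inj[OF that] by blast
  obtain L where L: "linear L" "L \<circ> dd \<Psi> p = id"
    using linear_injective_left_inverse[OF linear_dd[OF diff[OF p]] injd[OF p]] by blast
  define invf where "invf = Blinfun L"
  have "blinfun_apply invf = L"
    unfolding invf_def by (rule bounded_linear_Blinfun_apply) (simp add: L linear_conv_bounded_linear[symmetric])
  then have invf: "invf o\<^sub>L \<Psi>' p = id_blinfun"
    using L(2) by (intro blinfun_eqI) (simp add: \<Psi>'[OF p] fun_eq_iff)
  obtain U' V g g' where *: "open U'" "U' \<subseteq> U" "p \<in> U'" "open V" "homeomorphism U' V \<Psi> g"
    "\<And>y. y \<in> V \<Longrightarrow> (g has_derivative (g' y)) (at y)"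
    "\<And>y. y \<in> V \<Longrightarrow> g' y = inv_into UNIV (blinfun_apply (\<Psi>' (g y)))"
    using inverse_function_theorem[OF U _ cont p invf, of \<Psi>] has_derivative_dd[OF diff] \<Psi>' by metis
  have gV: "g ` V \<subseteq> U" using *(2,5) homeomorphism_image2 by metis
  define Z where "Z j q = inv_into UNIV (dd \<Psi> q) (axis j 1)" for j q
  have "Cinf U (Z j)" for j
  proof (rule Cinf_linear_solve[OF U])
    show "Cinf U (\<lambda>q. matrix (dd \<Psi> q) $ i $ j)" for i j
      by (simp add: matrix_def flip: pd_eq_dd) (intro Cinf_vec_nth U Cinf_pd smooth)
    show "Cinf U (\<lambda>q. axis j 1 :: real^'n)" by (rule Cinf_const)
    fix q assume q: "q \<in> U"
    show "det (matrix (dd \<Psi> q)) \<noteq> 0"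
      using injd[OF q] linear_dd[OF diff[OF q]] by (simp add: det_nz_iff_inj)
    have "surj (dd \<Psi> q)"
      using linear_injective_imp_surjective[OF linear_dd[OF diff[OF q]] injd[OF q]] by simp
    then show "matrix (dd \<Psi> q) *v Z j q = axis j 1"
      by (simp add: Z_def matrix_mult_linear[OF linear_dd[OF diff[OF q]]] surj_f_inv_f)
  qed
  moreover have "g' y (axis j 1) = Z j (g y)" if "y \<in> V" for j y
    using *(7)[OF that] gV that by (simp add: Z_def \<Psi>' image_subset_iff)
  moreover have "Ck n V g" for n
  proof (induction n)
    case 0
    show ?case
      using *(6) by (simp add: differentiable_on_eq_differentiable_at[OF *(4)] differentiable_def) blast
  next
    case (Suc n)
    show ?case
    proof (rule Ck_SucI[OF *(4,6)])
      fix j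
      have "Ck n V (\<lambda>y. Z j (g y))"
        by (rule Ck_compose[OF *(4) U Suc calculation(1) gV])
      then show "Ck n V (\<lambda>y. g' y (axis j 1))"
        by (rule Ck_cong_imp[OF *(4), rotated]) (simp add: calculation(2))
    qed
  qed
  ultimately show ?thesis
    using that[OF *(1-5)] CinfI by blast
qed

subsection \<open>Fields of linear forms and the Gauss formula\<close>

lemma dd_const [simp]: "dd (\<lambda>x. c) p u = 0"
  by (simp add: dd_def)

lemma dd_add:
  "f differentiable at p \<Longrightarrow> g differentiable at p \<Longrightarrow> dd (\<lambda>x. f x + g x) p u = dd f p u + dd g p u"
  by (rule dd_eqI) (intro has_derivative_add has_derivative_dd)

lemma dd_minus: "f differentiable at p \<Longrightarrow> dd (\<lambda>x. - f x) p u = - dd f p u"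
  by (rule dd_eqI) (intro has_derivative_minus has_derivative_dd)

lemma dd_diff:
  "f differentiable at p \<Longrightarrow> g differentiable at p \<Longrightarrow> dd (\<lambda>x. f x - g x) p u = dd f p u - dd g p u"
  by (rule dd_eqI) (intro has_derivative_diff has_derivative_dd)

lemma dd_scaleR:
  "f differentiable at p \<Longrightarrow> g differentiable at p \<Longrightarrow>
    dd (\<lambda>x. f x *\<^sub>R g x) p u = f p *\<^sub>R dd g p u + dd f p u *\<^sub>R g p"
  by (rule dd_eqI) (intro has_derivative_scaleR has_derivative_dd)

lemma dd_mult:
  fixes f g :: "'a::real_normed_vector \<Rightarrow> 'b::real_normed_algebra"
  shows "f differentiable at p \<Longrightarrow> g differentiable at p \<Longrightarrow>
    dd (\<lambda>x. f x * g x) p u = f p * dd g p u + dd f p u * g p"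
  by (rule dd_eqI) (intro has_derivative_mult has_derivative_dd)

lemma dd_sum:
  "(\<And>i. i \<in> I \<Longrightarrow> f i differentiable at p) \<Longrightarrow> dd (\<lambda>x. \<Sum>i\<in>I. f i x) p u = (\<Sum>i\<in>I. dd (f i) p u)"
  by (rule dd_eqI) (intro has_derivative_sum has_derivative_dd)

lemma dd_vec_nth: "f differentiable at p \<Longrightarrow> dd (\<lambda>x. f x $ i) p u = dd f p u $ i"
  by (rule dd_bounded_linear[OF bounded_linear_vec_nth])

context
  fixes U :: "(real^'n) set" and \<alpha> :: "real^'n \<Rightarrow> real^'m \<Rightarrow> 'b::real_normed_vector"
  assumes U: "open U"
    and lin: "\<And>q. q \<in> U \<Longrightarrow> linear (\<alpha> q)"
    and smooth: "\<And>v. Cinf U (\<lambda>q. \<alpha> q v)"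
begin

lemma Cinf_linear_field:
  assumes "Cinf U X"
  shows "Cinf U (\<lambda>q. \<alpha> q (X q))"
proof (rule Cinf_cong_imp[OF U])
  show "Cinf U (\<lambda>q. \<Sum>i\<in>UNIV. X q $ i *\<^sub>R \<alpha> q (axis i 1))"
    by (intro Cinf_sum Cinf_scaleR Cinf_vec_nth U assms smooth)
  show "(\<Sum>i\<in>UNIV. X q $ i *\<^sub>R \<alpha> q (axis i 1)) = \<alpha> q (X q)" if "q \<in> U" for q
    by (rule linear_axis_expand[OF lin[OF that], symmetric])
qed

lemma dd_linear_field:
  assumes X: "Cinf U X" and p: "p \<in> U"
  shows "dd (\<lambda>q. \<alpha> q (X q)) p u = dd (\<lambda>q. \<alpha> q (X p)) p u + \<alpha> p (dd X p u)"
proof -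
  have expand: "dd (\<lambda>q. \<alpha> q (Y q)) p u
      = (\<Sum>i\<in>UNIV. Y p $ i *\<^sub>R dd (\<lambda>q. \<alpha> q (axis i 1)) p u) + \<alpha> p (dd Y p u)" if Y: "Cinf U Y" for Y
  proof -
    have [simp]: "(\<lambda>q. \<alpha> q v) differentiable at p" for v
      by (rule Cinf_differentiable_at[OF smooth U p])
    have [simp]: "(\<lambda>q. Y q $ i) differentiable at p" for i
      by (rule Cinf_differentiable_at[OF Cinf_vec_nth[OF U Y] U p])
    have [simp]: "Y differentiable at p"
      by (rule Cinf_differentiable_at[OF Y U p])
    have "dd (\<lambda>q. \<alpha> q (Y q)) p u = dd (\<lambda>q. \<Sum>i\<in>UNIV. Y q $ i *\<^sub>R \<alpha> q (axis i 1)) p u"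
      by (rule arg_cong[where f = "\<lambda>D. D u"], rule dd_cong[OF U p], rule linear_axis_expand[OF lin])
    also have "\<dots> = (\<Sum>i\<in>UNIV. dd (\<lambda>q. Y q $ i *\<^sub>R \<alpha> q (axis i 1)) p u)"
      by (rule dd_sum) (intro differentiable_scaleR; simp)
    also have "\<dots> = (\<Sum>i\<in>UNIV. Y p $ i *\<^sub>R dd (\<lambda>q. \<alpha> q (axis i 1)) p u + dd Y p u $ i *\<^sub>R \<alpha> p (axis i 1))"
      by (simp add: dd_scaleR dd_vec_nth)
    finally show ?thesis
      by (simp add: sum.distrib flip: linear_axis_expand[OF lin[OF p]])
  qed
  show ?thesis
    using expand[OF X] expand[OF Cinf_const[of U "X p"]] by (simp add: linear_0[OF lin[OF p]])
qed

lemma linear_dd_linear_field: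
  assumes p: "p \<in> U"
  shows "linear (\<lambda>v. dd (\<lambda>q. \<alpha> q v) p u)"
proof (rule linearI)
  have d: "(\<lambda>q. \<alpha> q v) differentiable at p" for v
    by (rule Cinf_differentiable_at[OF smooth U p])
  show "dd (\<lambda>q. \<alpha> q (v + w)) p u = dd (\<lambda>q. \<alpha> q v) p u + dd (\<lambda>q. \<alpha> q w) p u" for v w
    using dd_cong[OF U p, of "\<lambda>q. \<alpha> q (v + w)" "\<lambda>q. \<alpha> q v + \<alpha> q w"]
    by (simp add: linear_add[OF lin] dd_add d)
  show "dd (\<lambda>q. \<alpha> q (c *\<^sub>R v)) p u = c *\<^sub>R dd (\<lambda>q. \<alpha> q v) p u" for c v
    using dd_cong[OF U p, of "\<lambda>q. \<alpha> q (c *\<^sub>R v)" "\<lambda>q. c *\<^sub>R \<alpha> q v"]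
    by (simp add: linear_cmul[OF lin] dd_scaleR d)
qed

end

lemma
  fixes B :: "real^'n \<Rightarrow> real^'m \<Rightarrow> real^'k \<Rightarrow> 'b::real_normed_vector"
  assumes U: "open U" and bil: "\<And>q. q \<in> U \<Longrightarrow> bilinear (B q)"
    and smooth: "\<And>u v. Cinf U (\<lambda>q. B q u v)" and X: "Cinf U X" and Y: "Cinf U Y"
  shows Cinf_bilinear_field: "Cinf U (\<lambda>q. B q (X q) (Y q))"
    and dd_bilinear_field: "p \<in> U \<Longrightarrow> dd (\<lambda>q. B q (X q) (Y q)) p w
      = dd (\<lambda>q. B q (X p) (Y p)) p w + B p (dd X p w) (Y p) + B p (X p) (dd Y p w)"
proof -
  have lin: "linear (\<lambda>u. B q u v)" "linear (B q u)" if "q \<in> U" for q u v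
    using bil[OF that] by (auto simp: bilinear_def)
  have X': "Cinf U (\<lambda>q. B q (X q) v)" for v
    by (rule Cinf_linear_field[where \<alpha> = "\<lambda>q u. B q u v", OF U lin(1) smooth X])
  show "Cinf U (\<lambda>q. B q (X q) (Y q))"
    by (rule Cinf_linear_field[where \<alpha> = "\<lambda>q v. B q (X q) v", OF U lin(2) X' Y])
  assume p: "p \<in> U"
  show "dd (\<lambda>q. B q (X q) (Y q)) p w
      = dd (\<lambda>q. B q (X p) (Y p)) p w + B p (dd X p w) (Y p) + B p (X p) (dd Y p w)"
    using dd_linear_field[where \<alpha> = "\<lambda>q u. B q u (Y p)", OF U lin(1) smooth X p, of w]
      dd_linear_field[where \<alpha> = "\<lambda>q v. B q (X q) v", OF U lin(2) X' Y p, of w] by simp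
qed

definition lie :: "('a::real_normed_vector \<Rightarrow> 'a) \<Rightarrow> ('a \<Rightarrow> 'a) \<Rightarrow> 'a \<Rightarrow> 'a" where
  "lie X Y p = dd Y p (X p) - dd X p (Y p)"

text \<open>The second-order parts cancel by symmetry of the second derivative; what remains comes
  from differentiating the fields and is the bracket.\<close>

lemma dd_commutator:
  fixes F :: "real^'n \<Rightarrow> 'b::euclidean_space"
  assumes U: "open U" and F: "Cinf U F" and X: "Cinf U X" and Y: "Cinf U Y" and p: "p \<in> U"
  shows "dd (\<lambda>q. dd F q (Y q)) p (X p) - dd (\<lambda>q. dd F q (X q)) p (Y p) = dd F p (lie X Y p)"
proof -
  have lin: "linear (dd F q)" if "q \<in> U" for q
    by (rule linear_dd[OF Cinf_differentiable_at[OF F U that]])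
  have smooth: "Cinf U (\<lambda>q. dd F q v)" for v
    by (intro Cinf_dd U F Cinf_const)
  have "dd (\<lambda>q. dd F q (Y q)) p (X p) = dd (\<lambda>q. dd F q (Y p)) p (X p) + dd F p (dd Y p (X p))"
    by (rule dd_linear_field[OF U lin smooth Y p])
  moreover have "dd (\<lambda>q. dd F q (X q)) p (Y p) = dd (\<lambda>q. dd F q (X p)) p (Y p) + dd F p (dd X p (Y p))"
    by (rule dd_linear_field[OF U lin smooth X p])
  ultimately show ?thesis
    using dd_dd_commute[OF U F p, of "X p" "Y p"]
    by (simp add: lie_def linear_diff[OF lin[OF p]])
qed

lemma vector_4:
  "(vector [x,y,z,w] :: 'a::zero^4) $ 1 = x" "(vector [x,y,z,w] :: 'a::zero^4) $ 2 = y"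
  "(vector [x,y,z,w] :: 'a::zero^4) $ 3 = z" "(vector [x,y,z,w] :: 'a::zero^4) $ 4 = w"
  by (simp_all add: vector_def)

lemma det_nz_solution_unique:
  fixes A :: "real^'n^'n"
  assumes "det A \<noteq> 0" "A *v x = A *v y"
  shows "x = y"
  using cramer[OF assms(1), of x "A *v y"] cramer[OF assms(1), of y "A *v y"] assms(2) by simp

text \<open>\<open>m\<close> is the function a_6 of the frame.\<close>

locale S3_hypersphere =
  fixes U :: "(real^3) set"
    and \<phi> \<xi> :: "real^3 \<Rightarrow> real^4"
    and h :: "real^3 \<Rightarrow> real^3 \<Rightarrow> real^3 \<Rightarrow> real"
    and \<Gamma> :: "real^3 \<Rightarrow> real^3 \<Rightarrow> real^3 \<Rightarrow> real^3"
    and S :: "real^3 \<Rightarrow> real^3 \<Rightarrow> real^3"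
    and T V W :: "real^3 \<Rightarrow> real^3"
    and m :: "real^3 \<Rightarrow> real"
  assumes blaschke: "blaschke_structure U \<phi> \<xi> h \<Gamma> S"
    and improper: "improper_affine_hypersphere U S"
    and frame: "S3_frame U h (diff_tensor h \<Gamma>) T V W m"
begin

lemma open_U: "open U" and smooth_\<phi>: "Cinf U \<phi>" and smooth_\<xi>: "Cinf U \<xi>"
  using blaschke by (auto simp: blaschke_structure_def)

lemma bilinear_h: "p \<in> U \<Longrightarrow> bilinear (h p)" and bilinear_\<Gamma>: "p \<in> U \<Longrightarrow> bilinear (\<Gamma> p)"
  using blaschke by (auto simp: blaschke_structure_def)

lemma gauss_formula:
  "p \<in> U \<Longrightarrow> dd (\<lambda>q. dd \<phi> q v) p u = dd \<phi> p (\<Gamma> p u v) + h p u v *\<^sub>R \<xi> p"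
  using blaschke by (auto simp: blaschke_structure_def)

lemma linear_d\<phi>: "p \<in> U \<Longrightarrow> linear (dd \<phi> p)"
  by (rule linear_dd[OF Cinf_differentiable_at[OF smooth_\<phi> open_U]])

lemma dd_\<xi>: "p \<in> U \<Longrightarrow> dd \<xi> p u = 0"
  using blaschke improper linear_0[OF linear_d\<phi>]
  by (simp add: blaschke_structure_def improper_affine_hypersphere_def)

lemma vol4_nz: "p \<in> U \<Longrightarrow> vol4 \<phi> \<xi> p \<noteq> 0"
  using blaschke unfolding blaschke_structure_def by (metis abs_eq_0 power_zero_numeral)

text \<open>Multiplication by this matrix splits \<open>\<real>^4\<close> into tangential and affine normal parts, so that Cramer's
  rule yields smoothness of \<open>h\<close> and \<open>\<Gamma>\<close>, which are not assumed to be smooth.\<close>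
definition fmat :: "real^3 \<Rightarrow> real^4^4" where
  "fmat p = transpose (vector [dd \<phi> p (axis 1 1), dd \<phi> p (axis 2 1), dd \<phi> p (axis 3 1), \<xi> p])"

lemma det_fmat: "p \<in> U \<Longrightarrow> det (fmat p) \<noteq> 0"
  using vol4_nz by (simp add: fmat_def det_transpose vol4_def)

lemma fmat_mult:
  assumes "p \<in> U"
  shows "fmat p *v x = dd \<phi> p (vector [x $ 1, x $ 2, x $ 3]) + x $ 4 *\<^sub>R \<xi> p"
  by (subst linear_axis_expand[OF linear_d\<phi>[OF assms]])
    (simp add: vec_eq_iff fmat_def matrix_vector_mult_def transpose_def sum_3 sum_4 vector_4 mult.commute)

lemma Cinf_fmat: "Cinf U (\<lambda>p. fmat p $ i $ j)"
proof -
  have d: "Cinf U (\<lambda>p. dd \<phi> p u $ i)" for u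
    by (intro Cinf_vec_nth Cinf_dd open_U smooth_\<phi> Cinf_const)
  have x: "Cinf U (\<lambda>p. \<xi> p $ i)"
    by (intro Cinf_vec_nth open_U smooth_\<xi>)
  show ?thesis
    using exhaust_4[of j] by (elim disjE) (simp_all add: fmat_def transpose_def vector_4 d x)
qed

lemma transversal:
  assumes "p \<in> U" "dd \<phi> p u + c *\<^sub>R \<xi> p = dd \<phi> p v + d *\<^sub>R \<xi> p"
  shows "u = v" "c = d"
proof -
  let ?x = "\<lambda>u c. vector [u $ 1, u $ 2, u $ 3, c] :: real^4"
  have v3: "vector [u $ 1, u $ 2, u $ 3] = u" for u :: "real^3"
    by (simp add: vec_eq_iff forall_3)
  have "fmat p *v ?x u c = fmat p *v ?x v d"
    using assms by (simp add: fmat_mult vector_4 v3)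
  then have "?x u c = ?x v d"
    by (rule det_nz_solution_unique[OF det_fmat[OF assms(1)]])
  then show "u = v" "c = d"
    by (simp_all add: vec_eq_iff forall_3 forall_4 vector_4)
qed

lemma Cinf_h: "Cinf U (\<lambda>q. h q u v)" and Cinf_\<Gamma>: "Cinf U (\<lambda>q. \<Gamma> q u v)"
proof -
  let ?x = "\<lambda>q. vector [\<Gamma> q u v $ 1, \<Gamma> q u v $ 2, \<Gamma> q u v $ 3, h q u v] :: real^4"
  have v3: "vector [u $ 1, u $ 2, u $ 3] = u" for u :: "real^3"
    by (simp add: vec_eq_iff forall_3)
  have "Cinf U ?x"
  proof (rule Cinf_linear_solve[OF open_U Cinf_fmat _ det_fmat])
    show "Cinf U (\<lambda>q. dd (\<lambda>r. dd \<phi> r v) q u)"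
      by (intro Cinf_dd open_U smooth_\<phi> Cinf_const)
    show "fmat q *v ?x q = dd (\<lambda>r. dd \<phi> r v) q u" if "q \<in> U" for q
      using that by (simp add: fmat_mult gauss_formula vector_4 v3)
  qed
  then have c: "Cinf U (\<lambda>q. ?x q $ i)" for i
    by (rule Cinf_vec_nth[OF open_U])
  show "Cinf U (\<lambda>q. h q u v)"
    using c[of 4] by (simp add: vector_4)
  show "Cinf U (\<lambda>q. \<Gamma> q u v)"
  proof (rule Cinf_vecI[OF open_U])
    show "Cinf U (\<lambda>q. \<Gamma> q u v $ i)" for i
      using exhaust_3[of i] c[of 1] c[of 2] c[of 3] by (auto simp: vector_4)
  qed
qed

text \<open>The second derivative of \<open>\<phi>\<close> is symmetric, and its tangential and
  normal parts are determined separately by transversality.\<close>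

lemma
  assumes "p \<in> U"
  shows \<Gamma>_sym: "\<Gamma> p u v = \<Gamma> p v u" and h_sym: "h p u v = h p v u"
proof -
  have "dd \<phi> p (\<Gamma> p u v) + h p u v *\<^sub>R \<xi> p = dd \<phi> p (\<Gamma> p v u) + h p v u *\<^sub>R \<xi> p"
    unfolding gauss_formula[OF assms, symmetric] by (rule dd_dd_commute[OF open_U smooth_\<phi> assms])
  from transversal[OF assms this] show "\<Gamma> p u v = \<Gamma> p v u" "h p u v = h p v u" .
qed

end

subsection \<open>Structure equations in the frame\<close>

context S3_hypersphere
begin

lemma smooth_T: "Cinf U T" and smooth_V: "Cinf U V" and smooth_W: "Cinf U W" and smooth_m: "Cinf U m"
  using frame by (auto simp: S3_frame_def)

lemma m_pos: "p \<in> U \<Longrightarrow> m p > 0"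
  using frame by (auto simp: S3_frame_def)

lemma h_linear:
  assumes "p \<in> U"
  shows "h p (x + y) z = h p x z + h p y z" "h p z (x + y) = h p z x + h p z y"
    "h p (x - y) z = h p x z - h p y z" "h p z (x - y) = h p z x - h p z y"
    "h p (c *\<^sub>R x) z = c * h p x z" "h p z (c *\<^sub>R x) = c * h p z x"
    "h p (- x) z = - h p x z" "h p z (- x) = - h p z x"
    "h p 0 z = 0" "h p z 0 = 0"
  using bilinear_h[OF assms]
  by (simp_all add: bilinear_ladd bilinear_radd bilinear_lsub bilinear_rsub bilinear_lmul bilinear_rmul
      bilinear_lneg bilinear_rneg bilinear_lzero bilinear_rzero)

lemma h_frame:
  assumes "p \<in> U"
  shows "h p (T p) (T p) = -1" "h p (V p) (V p) = 1" "h p (W p) (W p) = 1"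
    "h p (T p) (V p) = 0" "h p (T p) (W p) = 0" "h p (V p) (W p) = 0"
    "h p (V p) (T p) = 0" "h p (W p) (T p) = 0" "h p (W p) (V p) = 0"
  using frame assms h_sym[OF assms, of "V p" "T p"] h_sym[OF assms, of "W p" "T p"] h_sym[OF assms, of "W p" "V p"]
  by (auto simp: S3_frame_def)

definition fr :: "real^3 \<Rightarrow> real \<Rightarrow> real \<Rightarrow> real \<Rightarrow> real^3" where
  "fr p x y z = x *\<^sub>R T p + y *\<^sub>R V p + z *\<^sub>R W p"

lemma fr_add: "fr p x y z + fr p x' y' z' = fr p (x + x') (y + y') (z + z')"
  and fr_diff: "fr p x y z - fr p x' y' z' = fr p (x - x') (y - y') (z - z')"
  and fr_scaleR: "c *\<^sub>R fr p x y z = fr p (c * x) (c * y) (c * z)"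
  by (simp_all add: fr_def algebra_simps)

lemma h_fr:
  assumes "p \<in> U"
  shows "h p (fr p x y z) (T p) = - x" "h p (fr p x y z) (V p) = y" "h p (fr p x y z) (W p) = z"
  by (simp_all add: fr_def h_linear h_frame assms)

lemma fr_eq_iff: "p \<in> U \<Longrightarrow> fr p x y z = fr p x' y' z' \<longleftrightarrow> x = x' \<and> y = y' \<and> z = z'"
  using h_fr[of p x y z] h_fr[of p x' y' z'] by (metis minus_equation_iff)

text \<open>Pairing with the frame shows that coefficients are unique, so the frame spans by
  dimension. The minus sign reflects h(T, T) = -1.\<close>

lemma frame_expansion:
  assumes "p \<in> U"
  shows "u = fr p (- h p u (T p)) (h p u (V p)) (h p u (W p))"
proof -
  let ?f = "\<lambda>c :: real^3. fr p (c $ 1) (c $ 2) (c $ 3)"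
  have "linear ?f"
    by (rule linearI) (simp_all add: fr_add fr_scaleR)
  moreover have "inj ?f"
    by (rule injI, drule fr_eq_iff[OF assms, THEN iffD1]) (simp add: vec_eq_iff forall_3)
  ultimately have "surj ?f"
    by (intro linear_injective_imp_surjective refl)
  then obtain c where "u = ?f c" by (rule surjE)
  then show ?thesis by (simp add: h_fr[OF assms])
qed

lemma h_nondegenerate:
  assumes "p \<in> U" "\<And>w. h p x w = h p y w"
  shows "x = y"
  by (subst (1 2) frame_expansion[OF assms(1)]) (simp add: assms(2))

section \<open>Levi-Civita connection and difference tensor\<close>

abbreviation K :: "real^3 \<Rightarrow> real^3 \<Rightarrow> real^3 \<Rightarrow> real^3" where
  "K \<equiv> diff_tensor h \<Gamma>"

abbreviation lc :: "real^3 \<Rightarrow> real^3 \<Rightarrow> real^3 \<Rightarrow> real^3" where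
  "lc \<equiv> lc_chr h"

lemma linear_h: "p \<in> U \<Longrightarrow> linear (h p u)" "p \<in> U \<Longrightarrow> linear (\<lambda>u. h p u v)"
  using bilinear_h by (auto simp: bilinear_def)

text \<open>\<open>lc_chr\<close> is a definite description, so its defining formula needs existence
  and uniqueness. The right-hand side is linear in \<open>w\<close>, hence represented by the vector
  with the frame components in \<open>?z\<close>; nondegeneracy makes it unique.\<close>

lemma koszul:
  assumes p: "p \<in> U"
  shows "h p (lc p u v) w =
    (dd (\<lambda>q. h q v w) p u + dd (\<lambda>q. h q u w) p v - dd (\<lambda>q. h q u v) p w) / 2"
proof -
  let ?k = "\<lambda>w. (dd (\<lambda>q. h q v w) p u + dd (\<lambda>q. h q u w) p v - dd (\<lambda>q. h q u v) p w) / 2"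
  have lin: "linear (\<lambda>w. dd (\<lambda>q. h q v w) p u)" for u v
    by (rule linear_dd_linear_field[OF open_U linear_h(1) Cinf_h p])
  have d: "linear (dd (\<lambda>q. h q u v) p)"
    by (rule linear_dd[OF Cinf_differentiable_at[OF Cinf_h open_U p]])
  have k: "linear ?k"
    by (rule linearI)
      (simp_all add: linear_add[OF lin] linear_cmul[OF lin] linear_add[OF d] linear_cmul[OF d] field_simps)
  let ?z = "fr p (- ?k (T p)) (?k (V p)) (?k (W p))"
  have z: "h p ?z w = ?k w" for w
  proof -
    have h: "h p ?z (fr p x y z) = x * ?k (T p) + y * ?k (V p) + z * ?k (W p)" for x y z
      unfolding fr_def by (simp add: h_linear h_frame p)
    have "?k (fr p x y z) = x * ?k (T p) + y * ?k (V p) + z * ?k (W p)" for x y z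
      unfolding fr_def linear_add[OF k] linear_cmul[OF k] by simp
    moreover obtain x y z where "w = fr p x y z" using frame_expansion[OF p] by blast
    ultimately show ?thesis by (simp only: h)
  qed
  have "\<forall>w. h p (lc p u v) w = ?k w"
    unfolding lc_chr_def
  proof (rule theI[where a = ?z])
    show "\<forall>w. h p ?z w = ?k w" using z by blast
    show "x = ?z" if "\<forall>w. h p x w = ?k w" for x
      by (rule h_nondegenerate[OF p]) (simp only: z that)
  qed
  then show ?thesis by blast
qed

lemma dd_h_sym: "p \<in> U \<Longrightarrow> dd (\<lambda>q. h q u v) p = dd (\<lambda>q. h q v u) p"
  by (rule dd_cong[OF open_U]) (auto simp: h_sym)

lemma lc_sym: "p \<in> U \<Longrightarrow> lc p u v = lc p v u"
  by (rule h_nondegenerate) (auto simp: koszul dd_h_sym[of p u v] add.commute)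

lemma lc_metric:
  assumes p: "p \<in> U"
  shows "dd (\<lambda>q. h q v w) p u = h p (lc p u v) w + h p v (lc p u w)"
  unfolding h_sym[OF p, of v] koszul[OF p] dd_h_sym[OF p, of w v] by (simp add: field_simps)

lemma lc_cov_metric:
  assumes "p \<in> U" "Cinf U Y" "Cinf U Z"
  shows "dd (\<lambda>q. h q (Y q) (Z q)) p (X p) = h p (lc_cov h X Y p) (Z p) + h p (Y p) (lc_cov h X Z p)"
  using dd_bilinear_field[OF open_U bilinear_h Cinf_h assms(2,3,1), of "X p"]
  by (simp add: lc_metric[OF assms(1)] lc_cov_def h_linear[OF assms(1)])

lemma K_sym: "p \<in> U \<Longrightarrow> K p u v = K p v u"
  by (simp add: diff_tensor_def \<Gamma>_sym[of p u v] lc_sym[of p u v])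

lemma K_frame:
  assumes "p \<in> U"
  shows "K p (T p) x = 0" "K p x (T p) = 0"
    "K p (V p) (V p) = m p *\<^sub>R V p" "K p (V p) (W p) = - m p *\<^sub>R W p"
    "K p (W p) (V p) = - m p *\<^sub>R W p" "K p (W p) (W p) = - m p *\<^sub>R V p"
  using frame assms K_sym[OF assms, of x "T p"] K_sym[OF assms, of "W p" "V p"]
  by (simp_all add: S3_frame_def)

text \<open>The induced connection \<open>\<nabla>_u Z\<close>, with the differentiated field first;
  the direction is a single vector because the dependence on it is pointwise.\<close>

definition nb :: "(real^3 \<Rightarrow> real^3) \<Rightarrow> real^3 \<Rightarrow> real^3 \<Rightarrow> real^3" where
  "nb Z p u = dd Z p u + \<Gamma> p u (Z p)"

lemma nb_eq_lc_cov: "nb Z p (X p) = lc_cov h X Z p + K p (X p) (Z p)"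
  by (simp add: nb_def lc_cov_def diff_tensor_def)

lemma Cinf_nb: "Cinf U X \<Longrightarrow> Cinf U Z \<Longrightarrow> Cinf U (\<lambda>q. nb Z q (X q))"
  unfolding nb_def by (intro Cinf_add Cinf_dd Cinf_bilinear_field[OF open_U bilinear_\<Gamma> Cinf_\<Gamma>] open_U)

lemma linear_nb: "p \<in> U \<Longrightarrow> Cinf U Z \<Longrightarrow> linear (nb Z p)"
  using bilinear_\<Gamma>[of p] linear_dd[OF Cinf_differentiable_at[OF _ open_U], of Z p]
  unfolding nb_def[abs_def] bilinear_def by (intro linear_compose_add) auto

lemma nb_fr:
  assumes p: "p \<in> U" and Z: "Cinf U Z"
  shows "nb Z p (fr p x y z) = x *\<^sub>R nb Z p (T p) + y *\<^sub>R nb Z p (V p) + z *\<^sub>R nb Z p (W p)"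
  by (simp add: fr_def linear_add[OF linear_nb[OF p Z]] linear_cmul[OF linear_nb[OF p Z]])

lemma lie_eq_nb: "p \<in> U \<Longrightarrow> lie X Y p = nb Y p (X p) - nb X p (Y p)"
  by (simp add: lie_def nb_def \<Gamma>_sym[of p "Y p" "X p"])

lemma nb_fr_field:
  assumes p: "p \<in> U" and f: "Cinf U f" "Cinf U g" "Cinf U k"
  shows "nb (\<lambda>q. fr q (f q) (g q) (k q)) p u = fr p (dd f p u) (dd g p u) (dd k p u)
    + f p *\<^sub>R nb T p u + g p *\<^sub>R nb V p u + k p *\<^sub>R nb W p u"
proof -
  have d: "F differentiable at p" if "Cinf U F" for F :: "real^3 \<Rightarrow> 'z::real_normed_vector"
    by (rule Cinf_differentiable_at[OF that open_U p])
  note d[OF f(1), simp] d[OF f(2), simp] d[OF f(3), simp]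
    d[OF smooth_T, simp] d[OF smooth_V, simp] d[OF smooth_W, simp]
  have "linear (\<Gamma> p u)" using bilinear_\<Gamma>[OF p] by (simp add: bilinear_def)
  then show ?thesis
    by (simp add: nb_def fr_def dd_add dd_scaleR differentiable_scaleR linear_add linear_cmul algebra_simps)
qed

lemma nb_cong:
  assumes "p \<in> U" "\<And>q. q \<in> U \<Longrightarrow> Y q = Z q"
  shows "nb Y p u = nb Z p u"
  using dd_cong[OF open_U assms] assms by (simp add: nb_def)

text \<open>Gauss formula for a varying field: the product rule contributes the derivative of
  \<open>Z\<close>, which completes \<open>\<Gamma>\<close> to \<open>\<nabla>\<close>.\<close>

lemma dd_d\<phi>_field:
  assumes "p \<in> U" "Cinf U Z"
  shows "dd (\<lambda>q. dd \<phi> q (Z q)) p u = dd \<phi> p (nb Z p u) + h p u (Z p) *\<^sub>R \<xi> p"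
proof -
  have "dd (\<lambda>q. dd \<phi> q (Z q)) p u = dd (\<lambda>q. dd \<phi> q (Z p)) p u + dd \<phi> p (dd Z p u)"
    by (rule dd_linear_field[OF open_U linear_d\<phi> _ assms(2,1)], assumption) (intro Cinf_dd open_U smooth_\<phi> Cinf_const)
  then show ?thesis
    by (simp add: gauss_formula[OF assms(1)] nb_def linear_add[OF linear_d\<phi>[OF assms(1)]])
qed

text \<open>The commutator identity of flat 4-space is applied to the image of \<open>Z\<close>
  under the differential of \<open>\<phi>\<close>. Since \<open>\<xi>\<close> is constant, no
  derivative of \<open>\<xi>\<close> adds a tangential term, and the tangential part states that
  \<open>\<nabla>\<close> has zero curvature.\<close>

lemma nb_flat:
  assumes p: "p \<in> U" and X: "Cinf U X" and Y: "Cinf U Y" and Z: "Cinf U Z"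
  shows "nb (\<lambda>q. nb Z q (Y q)) p (X p) - nb (\<lambda>q. nb Z q (X q)) p (Y p) = nb Z p (lie X Y p)"
proof -
  let ?F = "\<lambda>q. dd \<phi> q (Z q)"
  have F: "Cinf U ?F" by (intro Cinf_dd open_U smooth_\<phi> Z)
  have second: "dd (\<lambda>q. dd ?F q (Y q)) p u = dd \<phi> p (nb (\<lambda>q. nb Z q (Y q)) p u)
      + (h p u (nb Z p (Y p)) + dd (\<lambda>q. h q (Y q) (Z q)) p u) *\<^sub>R \<xi> p" if Y: "Cinf U Y" for Y u
  proof -
    have hs: "Cinf U (\<lambda>q. h q (Y q) (Z q))"
      by (rule Cinf_bilinear_field[OF open_U bilinear_h Cinf_h Y Z])
    have ns: "Cinf U (\<lambda>q. nb Z q (Y q))" by (rule Cinf_nb[OF Y Z])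
    have d: "(\<lambda>q. dd \<phi> q (nb Z q (Y q))) differentiable at p" "(\<lambda>q. h q (Y q) (Z q)) differentiable at p"
      "\<xi> differentiable at p"
      by (rule Cinf_differentiable_at[OF Cinf_dd[OF open_U smooth_\<phi> ns] open_U p]
          Cinf_differentiable_at[OF hs open_U p] Cinf_differentiable_at[OF smooth_\<xi> open_U p])+
    have "dd (\<lambda>q. dd ?F q (Y q)) p = dd (\<lambda>q. dd \<phi> q (nb Z q (Y q)) + h q (Y q) (Z q) *\<^sub>R \<xi> q) p"
      by (rule dd_cong[OF open_U p]) (rule dd_d\<phi>_field[OF _ Z])
    then show ?thesis
      by (simp add: dd_add dd_scaleR d differentiable_scaleR dd_\<xi>[OF p] dd_d\<phi>_field[OF p ns] algebra_simps)
  qed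
  let ?N = "\<lambda>X Y. nb (\<lambda>q. nb Z q (Y q)) p (X p)"
  let ?H = "\<lambda>X Y. h p (X p) (nb Z p (Y p)) + dd (\<lambda>q. h q (Y q) (Z q)) p (X p)"
  have "dd \<phi> p (?N X Y - ?N Y X) + (?H X Y - ?H Y X) *\<^sub>R \<xi> p = dd ?F p (lie X Y p)"
    unfolding dd_commutator[OF open_U F X Y p, symmetric] second[OF X] second[OF Y]
    by (simp add: linear_diff[OF linear_d\<phi>[OF p]] algebra_simps)
  also have "\<dots> = dd \<phi> p (nb Z p (lie X Y p)) + h p (lie X Y p) (Z p) *\<^sub>R \<xi> p"
    by (rule dd_d\<phi>_field[OF p Z])
  finally show ?thesis by (rule transversal(1)[OF p])
qed

text \<open>Flatness with all covariant derivatives written in frame components; each choice of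
  frame fields X, Y, Z becomes three scalar equations between connection coefficients.\<close>

lemma flat_frame:
  assumes p: "p \<in> U" and X: "Cinf U X" and Y: "Cinf U Y" and Z: "Cinf U Z"
    and s: "Cinf U f1" "Cinf U g1" "Cinf U k1" "Cinf U f2" "Cinf U g2" "Cinf U k2"
    and YZ: "\<And>q. q \<in> U \<Longrightarrow> nb Z q (Y q) = fr q (f1 q) (g1 q) (k1 q)"
    and XZ: "\<And>q. q \<in> U \<Longrightarrow> nb Z q (X q) = fr q (f2 q) (g2 q) (k2 q)"
    and XY: "lie X Y p = fr p x y z"
  shows "fr p (dd f1 p (X p)) (dd g1 p (X p)) (dd k1 p (X p))
      + f1 p *\<^sub>R nb T p (X p) + g1 p *\<^sub>R nb V p (X p) + k1 p *\<^sub>R nb W p (X p)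
    = fr p (dd f2 p (Y p)) (dd g2 p (Y p)) (dd k2 p (Y p))
      + f2 p *\<^sub>R nb T p (Y p) + g2 p *\<^sub>R nb V p (Y p) + k2 p *\<^sub>R nb W p (Y p)
      + (x *\<^sub>R nb Z p (T p) + y *\<^sub>R nb Z p (V p) + z *\<^sub>R nb Z p (W p))"
  using nb_flat[OF p X Y Z]
    nb_cong[where Y = "\<lambda>q. nb Z q (Y q)", OF p YZ, of "X p"] nb_fr_field[OF p s(1,2,3), of "X p"]
    nb_cong[where Y = "\<lambda>q. nb Z q (X q)", OF p XZ, of "Y p"] nb_fr_field[OF p s(4,5,6), of "Y p"]
  unfolding XY nb_fr[OF p Z] by (simp add: algebra_simps)

section \<open>Connection coefficients and the flatness equations\<close>

definition cf :: "(real^3 \<Rightarrow> real^3) \<Rightarrow> (real^3 \<Rightarrow> real^3) \<Rightarrow> (real^3 \<Rightarrow> real^3) \<Rightarrow> real^3 \<Rightarrow> real" where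
  "cf X Z E p = h p (lc_cov h X Z p) (E p)"

text \<open>Smoothness is obtained through lc = \<open>\<nabla>\<close> - K: \<open>\<Gamma>\<close>
  is smooth by the Gauss formula, and K on the frame is smooth by its explicit table.\<close>

lemma Cinf_cf:
  assumes "Cinf U X" "Cinf U Z" "Cinf U E" "Cinf U (\<lambda>q. K q (X q) (Z q))"
  shows "Cinf U (cf X Z E)"
proof -
  have "Cinf U (\<lambda>q. nb Z q (X q) - K q (X q) (Z q))"
    by (intro Cinf_diff open_U Cinf_nb assms)
  then have "Cinf U (lc_cov h X Z)"
    by (simp add: nb_eq_lc_cov)
  from Cinf_bilinear_field[OF open_U bilinear_h Cinf_h this assms(3)]
  show ?thesis by (simp add: cf_def[abs_def])
qed

lemma Cinf_K_frame:
  "Cinf U (\<lambda>q. K q (T q) (X q))"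
  "Cinf U (\<lambda>q. K q (V q) (T q))" "Cinf U (\<lambda>q. K q (V q) (V q))"
  "Cinf U (\<lambda>q. K q (W q) (T q))" "Cinf U (\<lambda>q. K q (W q) (V q))"
proof -
  have *: "Cinf U (\<lambda>q. m q *\<^sub>R V q)" "Cinf U (\<lambda>q. - m q *\<^sub>R W q)"
    by (intro Cinf_scaleR Cinf_minus open_U smooth_m smooth_V smooth_W)+
  show "Cinf U (\<lambda>q. K q (T q) (X q))"
  "Cinf U (\<lambda>q. K q (V q) (T q))" "Cinf U (\<lambda>q. K q (V q) (V q))"
  "Cinf U (\<lambda>q. K q (W q) (T q))" "Cinf U (\<lambda>q. K q (W q) (V q))"
    by (rule Cinf_cong_imp[OF open_U K_frame(1)[symmetric] Cinf_const]
        Cinf_cong_imp[OF open_U K_frame(2)[symmetric] Cinf_const]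
        Cinf_cong_imp[OF open_U K_frame(3)[symmetric] *(1)]
        Cinf_cong_imp[OF open_U K_frame(5)[symmetric] *(2)]; assumption)+
qed

lemma cf_antisym:
  assumes p: "p \<in> U" and Y: "Cinf U Y" and Z: "Cinf U Z"
    and c: "\<And>q. q \<in> U \<Longrightarrow> h q (Y q) (Z q) = c"
  shows "cf X Y Z p + cf X Z Y p = 0"
proof -
  have "dd (\<lambda>q. h q (Y q) (Z q)) p (X p) = 0"
    using dd_cong[OF open_U p c] by simp
  then show ?thesis
    unfolding lc_cov_metric[OF p Y Z] cf_def by (simp add: h_sym[OF p, of "Y p"])
qed

text \<open>Metric compatibility makes the coefficients skew; the sign of h(T, T) then gives equal
  instead of opposite entries between T and V, W.\<close>

lemma lc_cov_frame:
  assumes p: "p \<in> U"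
  shows "lc_cov h X T p = fr p 0 (cf X T V p) (cf X T W p)"
    "lc_cov h X V p = fr p (cf X T V p) 0 (cf X V W p)"
    "lc_cov h X W p = fr p (cf X T W p) (- cf X V W p) 0"
proof -
  note s = smooth_T smooth_V smooth_W
  have "cf X T T p = 0" "cf X V V p = 0" "cf X W W p = 0"
    using cf_antisym[OF p s(1) s(1) h_frame(1), of X] cf_antisym[OF p s(2) s(2) h_frame(2), of X]
      cf_antisym[OF p s(3) s(3) h_frame(3), of X] by simp_all
  moreover have "cf X V T p = - cf X T V p" "cf X W T p = - cf X T W p" "cf X W V p = - cf X V W p"
    using cf_antisym[OF p s(1) s(2) h_frame(4), of X] cf_antisym[OF p s(1) s(3) h_frame(5), of X]
      cf_antisym[OF p s(2) s(3) h_frame(6), of X] by simp_all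
  ultimately show "lc_cov h X T p = fr p 0 (cf X T V p) (cf X T W p)"
    "lc_cov h X V p = fr p (cf X T V p) 0 (cf X V W p)"
    "lc_cov h X W p = fr p (cf X T W p) (- cf X V W p) 0"
    using frame_expansion[OF p, of "lc_cov h X T p"] frame_expansion[OF p, of "lc_cov h X V p"]
      frame_expansion[OF p, of "lc_cov h X W p"] unfolding cf_def by simp_all
qed

text \<open>The nine coefficients of the Levi-Civita connection; \<open>a\<close> and \<open>b\<close> are \<open>\<alpha>22\<close> and \<open>\<alpha>23\<close>, and
  \<open>ot\<close>, \<open>ov\<close>, \<open>ow\<close> give the rotation of \<open>V, W\<close> in the directions \<open>T, V, W\<close>.\<close>
abbreviation "t2 \<equiv> cf T T V"
abbreviation "t3 \<equiv> cf T T W"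
abbreviation "ot \<equiv> cf T V W"
abbreviation "a \<equiv> cf V T V"
abbreviation "b \<equiv> cf V T W"
abbreviation "ov \<equiv> cf V V W"
abbreviation "c \<equiv> cf W T V"
abbreviation "d \<equiv> cf W T W"
abbreviation "ow \<equiv> cf W V W"

lemmas smooth_frame = smooth_T smooth_V smooth_W

lemma smooth_coeffs: "Cinf U t2" "Cinf U t3" "Cinf U ot" "Cinf U a" "Cinf U b" "Cinf U ov"
  "Cinf U c" "Cinf U d" "Cinf U ow"
  by (intro Cinf_cf smooth_frame Cinf_K_frame)+

lemma nb_table:
  assumes p: "p \<in> U"
  shows "nb T p (T p) = fr p 0 (t2 p) (t3 p)"
    "nb V p (T p) = fr p (t2 p) 0 (ot p)"
    "nb W p (T p) = fr p (t3 p) (- ot p) 0"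
    "nb T p (V p) = fr p 0 (a p) (b p)"
    "nb V p (V p) = fr p (a p) (m p) (ov p)"
    "nb W p (V p) = fr p (b p) (- ov p) (- m p)"
    "nb T p (W p) = fr p 0 (c p) (d p)"
    "nb V p (W p) = fr p (c p) 0 (ow p - m p)"
    "nb W p (W p) = fr p (d p) (- ow p - m p) 0"
  unfolding nb_eq_lc_cov lc_cov_frame[OF p] K_frame[OF p]
  by (simp_all add: fr_def algebra_simps)

lemma lie_frame:
  assumes p: "p \<in> U"
  shows "lie T V p = fr p (t2 p) (- a p) (ot p - b p)"
    "lie T W p = fr p (t3 p) (- ot p - c p) (- d p)"
    "lie V W p = fr p (b p - c p) (- ov p) (- ow p)"
  by (simp_all add: lie_eq_nb[OF p] nb_table[OF p] fr_diff)

text \<open>Flatness relates \<open>h\<close>-adjoint entries of the curvature. Its Gauss part is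
  skew and its Codazzi part self-adjoint, so suitable pairs of equations isolate one or the other;
  the algebraic Codazzi relations carry a factor \<open>m\<close>, which is positive. Derivatives of
  \<open>t2\<close>, \<open>t3\<close>, \<open>c\<close>, \<open>d\<close> remain in some
  conclusions because the argument stays at one point.\<close>

lemma
  assumes p: "p \<in> U"
  shows t2_0: "t2 p = 0" and t3_0: "t3 p = 0" and b_eq: "b p = 3 * ot p" and c_eq: "c p = - b p"
    and d_eq: "d p = a p"
    and dT_m: "dd m p (T p) = - a p * m p"
    and dV_m: "dd m p (V p) = - 3 * m p * ow p"
    and dW_m: "dd m p (W p) = 3 * m p * ov p"
    and dT_a0: "dd a p (T p) - dd t2 p (V p) + a p * a p + b p * c p - b p * ot p - c p * ot p - m p * t2 p
      + ov p * t3 p - t2 p * t2 p = 0"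
    and dT_b0: "dd b p (T p) - dd t3 p (V p) + a p * b p + a p * ot p + b p * d p - d p * ot p + m p * t3 p
      - ov p * t2 p - t2 p * t3 p = 0"
    and dVW0: "dd c p (V p) - dd a p (W p) + a p * ov p + b p * m p + b p * ow p - b p * t2 p + c p * m p
      + c p * ow p + c p * t2 p - d p * ov p = 0"
    and dVW1: "dd d p (V p) - dd b p (W p) + a p * m p - a p * ow p + b p * ov p - b p * t3 p + c p * ov p
      + c p * t3 p - d p * m p + d p * ow p = 0"
    and gauss: "dd ow p (V p) - dd ov p (W p) = a p * d p - b p * c p + b p * ot p - c p * ot p - 2 * (m p)\<^sup>2
      - (ov p)\<^sup>2 - (ow p)\<^sup>2"
proof -
  note s = Cinf_const[of U "0::real"] smooth_coeffs smooth_m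
  have sm: "Cinf U (\<lambda>q. - ot q)" "Cinf U (\<lambda>q. - ov q)" "Cinf U (\<lambda>q. - m q)" "Cinf U (\<lambda>q. ow q - m q)"
    "Cinf U (\<lambda>q. - ow q - m q)"
    by (intro Cinf_diff Cinf_minus open_U s)+
  have D: "dd (\<lambda>q. - ot q) p u = - dd ot p u" "dd (\<lambda>q. - ov q) p u = - dd ov p u"
    "dd (\<lambda>q. - m q) p u = - dd m p u" "dd (\<lambda>q. ow q - m q) p u = dd ow p u - dd m p u"
    "dd (\<lambda>q. - ow q - m q) p u = - dd ow p u - dd m p u" for u
    using s sm by (simp_all add: dd_minus dd_diff Cinf_differentiable_at[OF _ open_U p] Cinf_minus[OF open_U])
  note simps = D dd_const nb_table[OF p] fr_add fr_diff fr_scaleR fr_eq_iff[OF p]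
  \<comment> \<open>The three letters name X, Y, Z in R(X, Y)Z = 0.\<close>
  note TVT = flat_frame[OF p smooth_T smooth_V smooth_T s(1,5,6,1,2,3) nb_table(4,1) lie_frame(1)[OF p], unfolded simps]
  note TVV = flat_frame[OF p smooth_T smooth_V smooth_V s(5,11,7,2,1,4) nb_table(5,2) lie_frame(1)[OF p], unfolded simps]
  note TVW = flat_frame[OF p smooth_T smooth_V smooth_W s(6) sm(2,3) s(3) sm(1) s(1) nb_table(6,3) lie_frame(1)[OF p], unfolded simps]
  note TWV = flat_frame[OF p smooth_T smooth_W smooth_V s(8,1) sm(4) s(2,1,4) nb_table(8,2) lie_frame(2)[OF p], unfolded simps]
  note TWW = flat_frame[OF p smooth_T smooth_W smooth_W s(9) sm(5) s(1) s(3) sm(1) s(1) nb_table(9,3) lie_frame(2)[OF p], unfolded simps]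
  note VWT = flat_frame[OF p smooth_V smooth_W smooth_T s(1,8,9,1,5,6) nb_table(7,4) lie_frame(3)[OF p], unfolded simps]
  note VWV = flat_frame[OF p smooth_V smooth_W smooth_V s(8,1) sm(4) s(5,11,7) nb_table(8,5) lie_frame(3)[OF p], unfolded simps]
  note VWW = flat_frame[OF p smooth_V smooth_W smooth_W s(9) sm(5) s(1) s(6) sm(2,3) nb_table(9,6) lie_frame(3)[OF p], unfolded simps]
  have m: "m p \<noteq> 0" using m_pos[OF p] by simp
  \<comment> \<open>The V-component of R(T, V)T against the T-component of R(T, V)V: everything
    cancels except the Codazzi term.\<close>
  have "m p * t2 p = 0" using TVT TVV by algebra
  then show "t2 p = 0" using m by simp
  have "m p * t3 p = 0" using TVT TVW by algebra
  then show "t3 p = 0" using m by simp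
  have "m p * (b p - 3 * ot p) = 0" using TVV TVW by algebra
  then show b: "b p = 3 * ot p" using m by simp
  have "m p * (c p + 3 * ot p) = 0" using TWV by algebra
  then show "c p = - b p" using m b by simp
  show mT: "dd m p (T p) = - a p * m p" using TVV by algebra
  have "m p * (d p - a p) = 0" using TWV TWW mT by algebra
  then show "d p = a p" using m by simp
  show "dd m p (V p) = - 3 * m p * ow p" using VWV VWW by algebra
  show "dd m p (W p) = 3 * m p * ov p" using VWV by algebra
  show "dd a p (T p) - dd t2 p (V p) + a p * a p + b p * c p - b p * ot p - c p * ot p - m p * t2 p
      + ov p * t3 p - t2 p * t2 p = 0" using TVT by algebra
  show "dd b p (T p) - dd t3 p (V p) + a p * b p + a p * ot p + b p * d p - d p * ot p + m p * t3 p
      - ov p * t2 p - t2 p * t3 p = 0" using TVT by algebra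
  show "dd c p (V p) - dd a p (W p) + a p * ov p + b p * m p + b p * ow p - b p * t2 p + c p * m p
      + c p * ow p + c p * t2 p - d p * ov p = 0" using VWT by algebra
  show "dd d p (V p) - dd b p (W p) + a p * m p - a p * ow p + b p * ov p - b p * t3 p + c p * ov p
      + c p * t3 p - d p * m p + d p * ow p = 0" using VWT by algebra
  show "dd ow p (V p) - dd ov p (W p) = a p * d p - b p * c p + b p * ot p - c p * ot p - 2 * (m p)\<^sup>2
      - (ov p)\<^sup>2 - (ow p)\<^sup>2" using VWV VWW by algebra
qed

text \<open>Since t2 = t3 = 0, c = -b and d = a hold on all of the open set \<open>U\<close>, they
  may be differentiated; this eliminates the derivatives left over above.\<close>

lemma
  assumes p: "p \<in> U"
  shows dT_a: "dd a p (T p) = (b p)\<^sup>2 - (a p)\<^sup>2" and dT_b: "dd b p (T p) = - 2 * a p * b p"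
    and dV_b: "dd b p (V p) = - dd a p (W p)" and dW_b: "dd b p (W p) = dd a p (V p)"
    and codazzi_gauss: "dd ow p (V p) - dd ov p (W p)
      = (a p)\<^sup>2 + 5/3 * (b p)\<^sup>2 - 2 * (m p)\<^sup>2 - (ov p)\<^sup>2 - (ow p)\<^sup>2"
    and lie_TV: "lie T V p = fr p 0 (- a p) (- 2/3 * b p)"
    and lie_TW: "lie T W p = fr p 0 (2/3 * b p) (- a p)"
    and lie_VW: "lie V W p = fr p (2 * b p) (- ov p) (- ow p)"
proof -
  have z: "dd t2 p u = 0" "dd t3 p u = 0" "dd c p u = - dd b p u" "dd d p u = dd a p u" for u
    using dd_cong[OF open_U p, of t2 "\<lambda>_. 0"] dd_cong[OF open_U p, of t3 "\<lambda>_. 0"]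
      dd_cong[OF open_U p, of c "\<lambda>q. - b q"] dd_cong[OF open_U p, of d a]
    by (simp_all add: t2_0 t3_0 c_eq d_eq dd_minus Cinf_differentiable_at[OF smooth_coeffs(5) open_U p])
  note e = t2_0[OF p] t3_0[OF p] b_eq[OF p] c_eq[OF p] d_eq[OF p]
  show "dd a p (T p) = (b p)\<^sup>2 - (a p)\<^sup>2" using dT_a0[OF p, unfolded z] e by algebra
  show "dd b p (T p) = - 2 * a p * b p" using dT_b0[OF p, unfolded z] e by algebra
  show "dd b p (V p) = - dd a p (W p)" using dVW0[OF p, unfolded z] e by algebra
  show "dd b p (W p) = dd a p (V p)" using dVW1[OF p, unfolded z] e by algebra
  \<comment> \<open>The coefficient 5/3 below is 1 + 1/3 + 1/3: once from -bc and twice from the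
    products with ot = b/3.\<close>
  have "b p * c p = - (b p)\<^sup>2" "b p * ot p = (b p)\<^sup>2 / 3" "c p * ot p = - (b p)\<^sup>2 / 3"
    by (simp_all add: c_eq[OF p] b_eq[OF p] power2_eq_square)
  then show "dd ow p (V p) - dd ov p (W p)
      = (a p)\<^sup>2 + 5/3 * (b p)\<^sup>2 - 2 * (m p)\<^sup>2 - (ov p)\<^sup>2 - (ow p)\<^sup>2"
    unfolding gauss[OF p] d_eq[OF p] by (simp add: power2_eq_square)
  show "lie T V p = fr p 0 (- a p) (- 2/3 * b p)" "lie T W p = fr p 0 (2/3 * b p) (- a p)"
    "lie V W p = fr p (2 * b p) (- ov p) (- ow p)"
    using e by (simp_all add: lie_frame[OF p] fr_eq_iff[OF p])
qed

end

subsection \<open>The function zeta and the integrating factor\<close>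

text \<open>The quotient in \<open>slit\<close> is \<zeta>(p) / \<zeta>(p0), so the principal
  logarithm of it is smooth on \<open>B\<close>; \<open>B\<close> is a ball so that closed forms on
  it are exact.\<close>

locale S3_patch = S3_hypersphere +
  fixes B :: "(real^3) set" and p0 :: "real^3" and r :: real
  assumes nz: "\<And>p. p \<in> U \<Longrightarrow> (a p, b p) \<noteq> (0, 0)"
    and B: "B = ball p0 r" "0 < r" "B \<subseteq> U"
    and slit: "\<And>p. p \<in> B \<Longrightarrow> Complex (a p0) (b p0) / Complex (a p) (b p) \<notin> \<real>\<^sub>\<le>\<^sub>0"
begin

lemma open_B: "open B" and p0_B: "p0 \<in> B"
  using B by auto

lemma Cinf_B: "Cinf U F \<Longrightarrow> Cinf B F"
  using Cinf_subset B(3) by blast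

lemma BU: "p \<in> B \<Longrightarrow> p \<in> U"
  using B(3) by blast

lemma diff_B: "Cinf B F \<Longrightarrow> p \<in> B \<Longrightarrow> F differentiable at p"
  by (rule Cinf_differentiable_at[OF _ open_B])

lemma dd_fr:
  assumes "Cinf B F" "p \<in> B"
  shows "dd F p (fr p x y z) = x *\<^sub>R dd F p (T p) + y *\<^sub>R dd F p (V p) + z *\<^sub>R dd F p (W p)"
  using linear_dd[OF diff_B[OF assms]] by (simp add: fr_def linear_add linear_cmul)

text \<open>The commutator \<open>[V, W]\<close> has \<open>T\<close>-component \<open>2 b\<close>: this is the only source of the right-hand side.\<close>
lemma conjugate_pair:
  fixes P Q :: "real^3 \<Rightarrow> real"
  assumes P: "Cinf B P" and Q: "Cinf B Q" and p: "p \<in> B"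
    and CR: "\<And>q. q \<in> B \<Longrightarrow> dd P q (V q) = dd Q q (W q)" "\<And>q. q \<in> B \<Longrightarrow> dd P q (W q) = - dd Q q (V q)"
  shows "dd (\<lambda>q. dd P q (V q)) p (V p) + dd (\<lambda>q. dd P q (W q)) p (W p)
    = 2 * b p * dd Q p (T p) - ow p * dd P p (V p) + ov p * dd P p (W p)"
proof -
  have "dd (\<lambda>q. dd P q (V q)) p = dd (\<lambda>q. dd Q q (W q)) p"
    by (rule dd_cong[OF open_B p CR(1)])
  moreover have "dd (\<lambda>q. dd P q (W q)) p (W p) = - dd (\<lambda>q. dd Q q (V q)) p (W p)"
    using dd_cong[OF open_B p CR(2)]
    by (simp add: dd_minus diff_B[OF Cinf_dd[OF open_B Q Cinf_B[OF smooth_V]] p])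
  \<comment> \<open>VVP + WWP = VWQ - WVQ, which is the derivative of Q along [V, W].\<close>
  ultimately have "dd (\<lambda>q. dd P q (V q)) p (V p) + dd (\<lambda>q. dd P q (W q)) p (W p) = dd Q p (lie V W p)"
    using dd_commutator[OF open_B Q Cinf_B[OF smooth_V] Cinf_B[OF smooth_W] p] by simp
  then show ?thesis
    by (simp add: lie_VW[OF BU[OF p]] dd_fr[OF Q p] CR[OF p])
qed

definition z :: "real^3 \<Rightarrow> complex" where "z p = of_real (a p) + \<i> * of_real (b p)"

definition zeta :: "real^3 \<Rightarrow> complex" where "zeta p = inverse (z p)"

lemma z_nz: "p \<in> B \<Longrightarrow> z p \<noteq> 0" and zeta_nz: "p \<in> B \<Longrightarrow> zeta p \<noteq> 0"
  using nz[OF BU, of p] by (auto simp: z_def zeta_def complex_eq_iff)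

lemma Cinf_of_real: "Cinf B F \<Longrightarrow> Cinf B (\<lambda>q. of_real (F q) :: complex)"
  by (rule Cinf_bounded_linear[OF bounded_linear_of_real open_B])

lemma Cinf_Re: "Cinf B F \<Longrightarrow> Cinf B (\<lambda>q. Re (F q))" and Cinf_Im: "Cinf B F \<Longrightarrow> Cinf B (\<lambda>q. Im (F q))"
  by (rule Cinf_bounded_linear[OF bounded_linear_Re open_B] Cinf_bounded_linear[OF bounded_linear_Im open_B]; assumption)+

lemma dd_of_real: "Cinf B F \<Longrightarrow> p \<in> B \<Longrightarrow> dd (\<lambda>q. of_real (F q) :: complex) p u = of_real (dd F p u)"
  by (rule dd_bounded_linear[OF bounded_linear_of_real diff_B])

lemma dd_Re: "Cinf B F \<Longrightarrow> p \<in> B \<Longrightarrow> dd (\<lambda>q. Re (F q)) p u = Re (dd F p u)"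
  by (rule dd_bounded_linear[OF bounded_linear_Re diff_B])

lemma dd_Im: "Cinf B F \<Longrightarrow> p \<in> B \<Longrightarrow> dd (\<lambda>q. Im (F q)) p u = Im (dd F p u)"
  by (rule dd_bounded_linear[OF bounded_linear_Im diff_B])

lemma smooth_z: "Cinf B z"
  unfolding z_def[abs_def]
  by (intro Cinf_add Cinf_mult Cinf_const Cinf_of_real open_B Cinf_B smooth_coeffs)

lemma smooth_zeta: "Cinf B zeta"
  unfolding zeta_def[abs_def] by (intro Cinf_inverse open_B smooth_z z_nz)

lemma dd_z: "p \<in> B \<Longrightarrow> dd z p u = of_real (dd a p u) + \<i> * of_real (dd b p u)"
  unfolding z_def[abs_def]
  by (simp add: dd_add dd_mult dd_of_real differentiable_mult diff_B Cinf_of_real Cinf_B smooth_coeffs)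

lemma dd_zeta: "p \<in> B \<Longrightarrow> dd zeta p u = - dd z p u * (zeta p)\<^sup>2"
  unfolding zeta_def[abs_def]
  using dd_eqI[OF Deriv.has_derivative_inverse[OF z_nz has_derivative_dd[OF diff_B[OF smooth_z]]]]
  by (simp add: power2_eq_square)

lemma zeta_T: "p \<in> B \<Longrightarrow> dd zeta p (T p) = 1"
proof -
  assume p: "p \<in> B"
  have "dd z p (T p) = - (z p)\<^sup>2"
    unfolding dd_z[OF p] dT_a[OF BU[OF p]] dT_b[OF BU[OF p]]
    by (simp add: z_def complex_eq_iff power2_eq_square)
  then show ?thesis
    using z_nz[OF p] by (simp add: dd_zeta[OF p] zeta_def power2_eq_square field_simps)
qed

lemma zeta_W: "p \<in> B \<Longrightarrow> dd zeta p (W p) = \<i> * dd zeta p (V p)"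
  by (simp add: dd_zeta dd_z dV_b[OF BU] dW_b[OF BU] algebra_simps)

definition ell :: "real^3 \<Rightarrow> complex" where "ell p = Ln (zeta p / zeta p0)"

lemma slit_zeta: "p \<in> B \<Longrightarrow> zeta p / zeta p0 \<notin> \<real>\<^sub>\<le>\<^sub>0"
  using slit[of p] by (simp add: zeta_def z_def complex_of_real_i Complex_eq divide_inverse mult.commute)

lemma smooth_ell: "Cinf B ell"
  unfolding ell_def[abs_def]
  by (intro Cinf_Ln Cinf_divide smooth_zeta open_B Cinf_const slit_zeta zeta_nz p0_B)

lemma dd_ell:
  assumes p: "p \<in> B"
  shows "dd ell p u = dd zeta p u * z p"
proof -
  have "((\<lambda>q. zeta q / zeta p0) has_derivative (\<lambda>u. dd zeta p u / zeta p0)) (at p)"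
    using bounded_linear.has_derivative[OF bounded_linear_divide has_derivative_dd[OF diff_B[OF smooth_zeta p]]] .
  from dd_eqI[OF has_derivative_Ln[OF this slit_zeta[OF p]]]
  show ?thesis
    unfolding ell_def[abs_def] using zeta_nz[OF p0_B] by (simp add: zeta_def[of p] field_simps)
qed

lemma exp_ell: "p \<in> B \<Longrightarrow> zeta p = zeta p0 * exp (ell p)"
  using zeta_nz[of p] zeta_nz[OF p0_B] by (simp add: ell_def)

lemma ell_frame:
  assumes "p \<in> B"
  shows "dd ell p (T p) = z p" "dd ell p (W p) = \<i> * dd ell p (V p)"
  by (simp_all add: dd_ell zeta_T zeta_W assms)

text \<open>This is ln (m |\<zeta>|), written through \<open>ell\<close> so that its derivatives
  follow from those of \<open>ell\<close>.\<close>

definition k :: "real^3 \<Rightarrow> real" where "k p = ln (m p) + Re (ell p) + ln (cmod (zeta p0))"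

lemma smooth_lnm: "Cinf B (\<lambda>p. ln (m p))"
  by (intro Cinf_ln open_B Cinf_B smooth_m m_pos BU)

lemma smooth_k: "Cinf B k"
  unfolding k_def[abs_def] by (intro Cinf_add open_B smooth_lnm Cinf_Re smooth_ell Cinf_const)

lemma dd_lnm: "p \<in> B \<Longrightarrow> dd (\<lambda>p. ln (m p)) p u = dd m p u / m p"
  using dd_eqI[OF has_derivative_compose[OF has_derivative_dd DERIV_ln_divide[unfolded has_field_derivative_def]]]
    diff_B[OF Cinf_B[OF smooth_m]] m_pos[OF BU] by force

lemma dd_k: "p \<in> B \<Longrightarrow> dd k p u = dd m p u / m p + Re (dd ell p u)"
  unfolding k_def[abs_def]
  by (simp add: dd_add dd_lnm dd_Re differentiable_add smooth_ell diff_B smooth_lnm Cinf_Re)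

lemma cmod_zeta: "p \<in> B \<Longrightarrow> m p * cmod (zeta p) = exp (k p)"
  using exp_ell[of p] m_pos[OF BU, of p] zeta_nz[OF p0_B]
  by (simp add: k_def exp_add norm_mult norm_exp_eq_Re)

lemma lnm_frame:
  assumes "p \<in> B"
  shows "dd (\<lambda>p. ln (m p)) p (T p) = - a p" "dd (\<lambda>p. ln (m p)) p (V p) = - 3 * ow p"
    "dd (\<lambda>p. ln (m p)) p (W p) = 3 * ov p"
  using m_pos[OF BU[OF assms]]
  by (simp_all add: dd_lnm assms dT_m[OF BU] dV_m[OF BU] dW_m[OF BU])

lemma eta_T: "p \<in> B \<Longrightarrow> dd (\<lambda>q. Im (zeta q)) p (T p) = 0"
  by (simp add: dd_Im smooth_zeta zeta_T)

text \<open>T ln m = -a cancels the real part a of T ell = z.\<close>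

lemma k_T: "p \<in> B \<Longrightarrow> dd k p (T p) = 0"
  using m_pos[OF BU, of p] by (simp add: dd_k ell_frame dT_m[OF BU] z_def)

text \<open>The conjugate of Im \<zeta> is -Re \<zeta>, whose T-derivative is -1.\<close>

lemma laplace_eta:
  assumes p: "p \<in> B"
  defines "F \<equiv> \<lambda>q. Im (zeta q)"
  shows "dd (\<lambda>q. dd F q (V q)) p (V p) + dd (\<lambda>q. dd F q (W q)) p (W p)
    = - 2 * b p - ow p * dd F p (V p) + ov p * dd F p (W p)"
proof -
  have n: "Cinf B (\<lambda>q. - Re (zeta q))" by (intro Cinf_minus open_B Cinf_Re smooth_zeta)
  have "dd (\<lambda>q. - Re (zeta q)) q u = - Re (dd zeta q u)" if "q \<in> B" for q u
    using that by (simp add: dd_minus dd_Re smooth_zeta diff_B Cinf_Re)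
  then show ?thesis
    using conjugate_pair[OF _ n p, of F] p unfolding F_def
    by (simp add: dd_Im smooth_zeta Cinf_Im zeta_T zeta_W)
qed

text \<open>The part ln m contributes -3 (V ow - W ov), which the Gauss equation evaluates; the part
  Re ell has conjugate Im ell with T-derivative b and adds 2 b^2. Thus the coefficient of b^2 is -5
  + 2 = -3, equal to that of a^2, and the squares of \<open>ov\<close>, \<open>ow\<close>
  cancel.\<close>

lemma laplace_k:
  assumes p: "p \<in> B"
  shows "dd (\<lambda>q. dd k q (V q)) p (V p) + dd (\<lambda>q. dd k q (W q)) p (W p)
    = 6 * (m p)\<^sup>2 - 3 * ((a p)\<^sup>2 + (b p)\<^sup>2) - ow p * dd k p (V p) + ov p * dd k p (W p)"
proof -
  let ?L = "\<lambda>q. Re (ell q)"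
  have s: "Cinf B (\<lambda>q. dd ?L q (V q))" "Cinf B (\<lambda>q. dd ?L q (W q))" "Cinf B ow" "Cinf B ov"
    by (intro Cinf_dd open_B Cinf_Re smooth_ell Cinf_B smooth_frame smooth_coeffs)+
  have kV: "dd k q (V q) = - 3 * ow q + dd ?L q (V q)" and kW: "dd k q (W q) = 3 * ov q + dd ?L q (W q)"
    if "q \<in> B" for q
    using lnm_frame[OF that] by (simp_all add: dd_k dd_lnm dd_Re smooth_ell that)
  have "dd (\<lambda>q. dd k q (V q)) p (V p) = - 3 * dd ow p (V p) + dd (\<lambda>q. dd ?L q (V q)) p (V p)"
    using dd_cong[OF open_B p, of "\<lambda>q. dd k q (V q)" "\<lambda>q. - 3 * ow q + dd ?L q (V q)"] kV
    by (simp add: dd_diff dd_mult diff_B[OF _ p] s differentiable_mult)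
  moreover have "dd (\<lambda>q. dd k q (W q)) p (W p) = 3 * dd ov p (W p) + dd (\<lambda>q. dd ?L q (W q)) p (W p)"
    using dd_cong[OF open_B p, of "\<lambda>q. dd k q (W q)" "\<lambda>q. 3 * ov q + dd ?L q (W q)"] kW
    by (simp add: dd_add dd_mult diff_B[OF _ p] s differentiable_mult)
  moreover have "dd (\<lambda>q. dd ?L q (V q)) p (V p) + dd (\<lambda>q. dd ?L q (W q)) p (W p)
    = 2 * b p * b p - ow p * dd ?L p (V p) + ov p * dd ?L p (W p)"
    using conjugate_pair[OF _ _ p, of ?L "\<lambda>q. Im (ell q)"] p
    by (simp add: dd_Im dd_Re smooth_ell Cinf_Im Cinf_Re ell_frame z_def)
  ultimately show ?thesis
    using codazzi_gauss[OF BU[OF p]] by (simp add: kV[OF p] kW[OF p] power2_eq_square algebra_simps)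
qed

text \<open>The branch \<open>ell\<close> of the logarithm is normalised at \<open>p0\<close>; the term \<open>ln (cmod (zeta p0))\<close>
  restores the modulus, while a constant phase does not matter.\<close>
definition f :: "real^3 \<Rightarrow> complex" where
  "f p = exp (of_real (ln (m p) / 3) - of_real (2/3) * of_real (ln (cmod (zeta p0))) - of_real (2/3) * ell p)"

lemma smooth_f: "Cinf B f"
  unfolding f_def[abs_def]
  by (intro Cinf_exp Cinf_diff Cinf_mult Cinf_of_real Cinf_divide Cinf_const open_B smooth_lnm smooth_ell) auto

lemma f_nz: "f p \<noteq> 0"
  by (simp add: f_def)

text \<open>The exponents in \<open>f\<close> give |f|^2 = m^(2/3) |\<zeta>|^(-4/3) = (m
  |\<zeta>|)^(2/3) |z|^2.\<close>

lemma norm_f: "p \<in> B \<Longrightarrow> (cmod (f p))\<^sup>2 = exp (2/3 * k p) * ((a p)\<^sup>2 + (b p)\<^sup>2)"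
proof -
  assume p: "p \<in> B"
  have z: "(a p)\<^sup>2 + (b p)\<^sup>2 = (cmod (z p))\<^sup>2"
    by (simp add: z_def cmod_def)
  have "cmod (zeta p) = exp (Re (ell p) + ln (cmod (zeta p0)))"
    using exp_ell[OF p] zeta_nz[OF p0_B] by (simp add: exp_add norm_mult)
  moreover have "cmod (z p) = inverse (cmod (zeta p))"
    by (simp add: zeta_def norm_inverse)
  ultimately have "cmod (z p) = exp (- Re (ell p) - ln (cmod (zeta p0)))"
    by (simp only: flip: exp_minus) simp
  then have "(cmod (z p))\<^sup>2 = exp (2 * (- Re (ell p) - ln (cmod (zeta p0))))"
    by (simp only: exp_double)
  moreover have "(cmod (f p))\<^sup>2 = exp (2 * (ln (m p) / 3 - 2/3 * ln (cmod (zeta p0)) - 2/3 * Re (ell p)))"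
    unfolding exp_double by (simp add: f_def)
  ultimately show ?thesis
    unfolding z by (simp add: k_def flip: exp_add) (simp add: algebra_simps)
qed

lemma dd_f:
  assumes p: "p \<in> B"
  shows "dd f p u = f p * (of_real (dd (\<lambda>p. ln (m p)) p u / 3) - 2/3 * dd ell p u)"
proof -
  let ?g = "\<lambda>p. of_real (1/3) * of_real (ln (m p)) - of_real (2/3) * of_real (ln (cmod (zeta p0))) - of_real (2/3) * ell p"
  have s: "Cinf B (\<lambda>q. of_real (ln (m q)) :: complex)" by (intro Cinf_of_real smooth_lnm)
  have f: "f = (\<lambda>q. exp (?g q))" by (simp add: f_def fun_eq_iff)
  have g: "Cinf B ?g"
    by (intro Cinf_diff Cinf_mult Cinf_const s smooth_ell open_B)
  have "dd ?g p u = of_real (1/3) * of_real (dd (\<lambda>p. ln (m p)) p u) - of_real (2/3) * dd ell p u"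
    by (simp only: dd_diff dd_mult dd_const differentiable_diff differentiable_mult differentiable_const
        diff_B[OF s p] diff_B[OF smooth_ell p] dd_of_real[OF smooth_lnm p]
        mult_zero_left mult_zero_right add_0_right diff_zero)
  moreover have "dd f p u = exp (?g p) * dd ?g p u"
    unfolding f
    by (rule dd_eqI[OF has_derivative_compose[OF has_derivative_dd DERIV_exp[unfolded has_field_derivative_def]]])
      (rule diff_B[OF g p])
  ultimately show ?thesis by (simp add: f)
qed

text \<open>-a/3 from ln m and -2z/3 from \<open>ell\<close> add up to the multiplier of [T, V] and
  [T, W]; this fixes both weights.\<close>

lemma f_T: "p \<in> B \<Longrightarrow> dd f p (T p) = f p * (- of_real (a p) - \<i> * of_real (2/3 * b p))"
  by (simp add: dd_f lnm_frame ell_frame z_def field_simps)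

text \<open>\<open>ell\<close> drops out because (V + iW) ell = 0, and the weight 1/3 of ln m
  reduces -3 ow and 3 ov to the rotation coefficients of [V, W].\<close>

lemma f_VW: "p \<in> B \<Longrightarrow> dd f p (V p) + \<i> * dd f p (W p) = f p * (- of_real (ow p) + \<i> * of_real (ov p))"
  by (simp add: dd_f lnm_frame ell_frame algebra_simps)

end

subsection \<open>Isothermal coordinates\<close>

lemma bounded_linear_vw: "bounded_linear vw"
  unfolding linear_conv_bounded_linear[symmetric]
  by (rule linearI) (simp_all add: vw_def vec_eq_iff forall_2)

context S3_patch
begin

text \<open>Pairing with V and W is the dual coframe, as both are spacelike unit vectors orthogonal
  to the rest of the frame; T lies in the kernel.\<close>

definition \<theta> :: "real^3 \<Rightarrow> real^3 \<Rightarrow> complex" where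
  "\<theta> p u = f p * (of_real (h p u (V p)) + \<i> * of_real (h p u (W p)))"

lemma \<theta>_fr: "p \<in> B \<Longrightarrow> \<theta> p (fr p x y w) = f p * (of_real y + \<i> * of_real w)"
  by (simp add: \<theta>_def h_fr BU)

lemma \<theta>_frame:
  assumes "p \<in> B"
  shows "\<theta> p (T p) = 0" "\<theta> p (V p) = f p" "\<theta> p (W p) = \<i> * f p"
  by (simp_all add: \<theta>_def h_frame BU assms)

lemma linear_\<theta>: "p \<in> B \<Longrightarrow> linear (\<theta> p)"
  by (rule linearI) (simp_all add: \<theta>_def h_linear BU complex_eq_iff algebra_simps)

lemma Cinf_\<theta>: "Cinf B (\<lambda>q. \<theta> q u)"
proof -
  have "Cinf B (\<lambda>q. h q u (E q))" if "Cinf U E" for E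
    by (rule Cinf_B[OF Cinf_bilinear_field[OF open_U bilinear_h Cinf_h Cinf_const that]])
  then have "Cinf B (\<lambda>q. h q u (V q))" "Cinf B (\<lambda>q. h q u (W q))"
    using smooth_V smooth_W by blast+
  then show ?thesis
    unfolding \<theta>_def by (intro Cinf_add Cinf_mult Cinf_const Cinf_of_real open_B smooth_f)
qed

text \<open>\<open>D\<close> is the exterior derivative, bilinear and alternating, so it suffices to
  evaluate it on pairs of frame vectors, where the bracket relations meet the derivatives of
  \<open>f\<close>.\<close>

lemma \<theta>_closed:
  assumes p: "p \<in> B"
  shows "dd (\<lambda>q. \<theta> q v) p u = dd (\<lambda>q. \<theta> q u) p v"
proof -
  define D where "D u v = dd (\<lambda>q. \<theta> q v) p u - dd (\<lambda>q. \<theta> q u) p v" for u v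
  have l1: "linear (dd (\<lambda>q. \<theta> q v) p)" for v
    by (rule linear_dd[OF diff_B[OF Cinf_\<theta> p]])
  have l2: "linear (\<lambda>v. dd (\<lambda>q. \<theta> q v) p u)" for u
    by (rule linear_dd_linear_field[OF open_B linear_\<theta> Cinf_\<theta> p])
  have D: "linear (\<lambda>u. D u v)" "linear (D u)" for u v
    unfolding D_def[abs_def] by (intro linear_compose_sub l1 l2)+
  have anti: "D v u = - D u v" for u v by (simp add: D_def)
  \<comment> \<open>Cartan's formula: replacing constant arguments by fields costs
    \<theta>([X, Y]).\<close>
  have field: "D (X p) (Y p) = dd (\<lambda>q. \<theta> q (Y q)) p (X p) - dd (\<lambda>q. \<theta> q (X q)) p (Y p) - \<theta> p (lie X Y p)"
    if "Cinf U X" "Cinf U Y" for X Y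
    using dd_linear_field[where \<alpha> = \<theta>, OF open_B linear_\<theta> Cinf_\<theta> Cinf_B[OF that(1)] p, of "Y p"]
      dd_linear_field[where \<alpha> = \<theta>, OF open_B linear_\<theta> Cinf_\<theta> Cinf_B[OF that(2)] p, of "X p"]
    by (simp add: D_def lie_def linear_diff[OF linear_\<theta>[OF p]])
  have \<theta>: "dd (\<lambda>q. \<theta> q (T q)) p u = 0" "dd (\<lambda>q. \<theta> q (V q)) p u = dd f p u"
    "dd (\<lambda>q. \<theta> q (W q)) p u = \<i> * dd f p u" for u
    using dd_cong[OF open_B p, of "\<lambda>q. \<theta> q (T q)" "\<lambda>_. 0"] dd_cong[OF open_B p, of "\<lambda>q. \<theta> q (V q)" f]
      dd_cong[OF open_B p, of "\<lambda>q. \<theta> q (W q)" "\<lambda>q. \<i> * f q"]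
    by (simp_all add: \<theta>_frame dd_mult diff_B[OF smooth_f p])
  have TV: "D (T p) (V p) = 0"
    unfolding field[OF smooth_T smooth_V] \<theta> lie_TV[OF BU[OF p]] \<theta>_fr[OF p] f_T[OF p]
    by (simp add: algebra_simps)
  have TW: "D (T p) (W p) = 0"
    unfolding field[OF smooth_T smooth_W] \<theta> lie_TW[OF BU[OF p]] \<theta>_fr[OF p] f_T[OF p]
    by (simp add: algebra_simps)
  have "\<i> * dd f p (V p) - dd f p (W p) = \<i> * (dd f p (V p) + \<i> * dd f p (W p))"
    by (simp add: algebra_simps)
  then have VW: "D (V p) (W p) = 0"
    unfolding field[OF smooth_V smooth_W] \<theta> lie_VW[OF BU[OF p]] \<theta>_fr[OF p] f_VW[OF p]
    by (simp add: algebra_simps)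
  have self: "D u u = 0" for u by (simp add: D_def)
  have rest: "D (V p) (T p) = 0" "D (W p) (T p) = 0" "D (W p) (V p) = 0"
    using anti TV TW VW by (metis neg_equal_0_iff_equal)+
  obtain x y w x' y' w' where uv: "u = fr p x y w" "v = fr p x' y' w'"
    using frame_expansion[OF BU[OF p]] by blast
  have "D u v = 0"
    unfolding uv fr_def
    by (simp add: linear_add[OF D(1)] linear_cmul[OF D(1)] linear_add[OF D(2)] linear_cmul[OF D(2)] self TV TW VW rest)
  then show ?thesis by (simp add: D_def)
qed

lemma isothermal_exists: "\<exists>X. \<forall>p\<in>B. (X has_derivative \<theta> p) (at p)"
proof -
  have "Cinf (ball p0 r) (\<lambda>q. \<theta> q (axis i 1))" for i
    using Cinf_\<theta> B(1) by simp
  moreover have "pd i (\<lambda>q. \<theta> q (axis j 1)) p = pd j (\<lambda>q. \<theta> q (axis i 1)) p" if "p \<in> ball p0 r" for i j p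
    unfolding pd_eq_dd by (rule \<theta>_closed) (use that B(1) in simp)
  ultimately obtain X where X: "(X has_derivative (\<lambda>u. \<Sum>i\<in>UNIV. u $ i *\<^sub>R \<theta> p (axis i 1))) (at p)"
    if "p \<in> ball p0 r" for p
    using smooth_closed_form_exact[of p0 r "\<lambda>i q. \<theta> q (axis i 1)"] by blast
  have "(X has_derivative \<theta> p) (at p)" if "p \<in> B" for p
    using X[of p] that B(1) linear_axis_expand[OF linear_\<theta>[OF that], symmetric] by simp
  then show ?thesis by blast
qed

definition iso :: "real^3 \<Rightarrow> complex" where
  "iso = (SOME X. \<forall>p\<in>B. (X has_derivative \<theta> p) (at p))"

lemma iso_deriv: "p \<in> B \<Longrightarrow> (iso has_derivative \<theta> p) (at p)"
  unfolding iso_def using someI_ex[OF isothermal_exists] by blast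

lemma smooth_iso: "Cinf B iso"
  by (rule Cinf_derivI[OF open_B iso_deriv Cinf_\<theta>])

lemma dd_iso: "p \<in> B \<Longrightarrow> dd iso p u = \<theta> p u"
  by (rule dd_eqI[OF iso_deriv])

definition chart :: "real^3 \<Rightarrow> real^3" where
  "chart p = vector [Re (zeta p), Re (iso p), Im (iso p)]"

lemma chart_nth: "chart p $ 1 = Re (zeta p)" "chart p $ 2 = Re (iso p)" "chart p $ 3 = Im (iso p)"
  by (simp_all add: chart_def)

lemma smooth_chart: "Cinf B chart"
proof (rule Cinf_vecI[OF open_B])
  show "Cinf B (\<lambda>q. chart q $ i)" for i
    using exhaust_3[of i] Cinf_Re[OF smooth_zeta] Cinf_Re[OF smooth_iso] Cinf_Im[OF smooth_iso]
    by (auto simp: chart_nth)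
qed

lemma dd_chart:
  assumes p: "p \<in> B"
  shows "dd chart p u $ 1 = Re (dd zeta p u)" "dd chart p u $ 2 = Re (\<theta> p u)" "dd chart p u $ 3 = Im (\<theta> p u)"
  using dd_vec_nth[OF diff_B[OF smooth_chart p], of 1 u] dd_vec_nth[OF diff_B[OF smooth_chart p], of 2 u]
    dd_vec_nth[OF diff_B[OF smooth_chart p], of 3 u]
  by (simp_all add: chart_nth dd_Re dd_Im smooth_zeta smooth_iso dd_iso p)

lemma dd_chart_T: "p \<in> B \<Longrightarrow> dd chart p (T p) = axis 1 1"
  by (simp add: vec_eq_iff forall_3 dd_chart zeta_T \<theta>_frame axis_def)

text \<open>\<theta> is injective on the span of V and W, so only multiples of T could be killed,
  and T goes to the first axis vector.\<close>

lemma chart_immersive: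
  assumes p: "p \<in> B" and u: "dd chart p u = 0"
  shows "u = 0"
proof -
  obtain x y w where fr: "u = fr p x y w" using frame_expansion[OF BU[OF p]] by blast
  have "\<theta> p u = 0" using dd_chart(2,3)[OF p, of u] u by (simp add: complex_eq_iff)
  then have "of_real y + \<i> * of_real w = (0 :: complex)"
    using f_nz[of p] by (simp add: fr \<theta>_fr[OF p])
  then have "y = 0" "w = 0" by (simp_all add: complex_eq_iff)
  then have "u = x *\<^sub>R T p" by (simp add: fr fr_def)
  then have "x *\<^sub>R axis 1 1 = (0 :: real^3)"
    using u linear_cmul[OF linear_dd[OF diff_B[OF smooth_chart p]], of x "T p"] by (simp add: dd_chart_T[OF p])
  then show ?thesis using \<open>u = x *\<^sub>R T p\<close> by (simp add: axis_eq_0_iff)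
qed

lemma a_chart: "p \<in> B \<Longrightarrow> a p = Re (zeta p) / ((Re (zeta p))\<^sup>2 + (Im (zeta p))\<^sup>2)"
  and b_chart: "p \<in> B \<Longrightarrow> b p = - Im (zeta p) / ((Re (zeta p))\<^sup>2 + (Im (zeta p))\<^sup>2)"
proof -
  have "z p = inverse (zeta p)" by (simp add: zeta_def)
  then have "Re (z p) = Re (inverse (zeta p))" "Im (z p) = Im (inverse (zeta p))" by simp_all
  then show "a p = Re (zeta p) / ((Re (zeta p))\<^sup>2 + (Im (zeta p))\<^sup>2)"
    "b p = - Im (zeta p) / ((Re (zeta p))\<^sup>2 + (Im (zeta p))\<^sup>2)"
    by (simp_all add: z_def)
qed

lemma m_chart: "p \<in> B \<Longrightarrow> m p = exp (k p) / sqrt ((Re (zeta p))\<^sup>2 + (Im (zeta p))\<^sup>2)"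
  unfolding cmod_def[symmetric] using cmod_zeta[of p] zeta_nz[of p] by (simp add: field_simps)

lemma dd_function_of_vw:
  fixes G :: "real^2 \<Rightarrow> real"
  assumes N: "open N" "N \<subseteq> B" and D: "open D" and G: "Cinf D G"
    and img: "\<And>q. q \<in> N \<Longrightarrow> vw (chart q) \<in> D"
    and F: "\<And>q. q \<in> N \<Longrightarrow> F q = G (vw (chart q))" and p: "p \<in> N"
  shows "dd F p u = pd 1 G (vw (chart p)) * Re (\<theta> p u) + pd 2 G (vw (chart p)) * Im (\<theta> p u)"
proof -
  have pB: "p \<in> B" by (rule subsetD[OF N(2) p])
  have c: "((\<lambda>q. vw (chart q)) has_derivative (\<lambda>u. vw (dd chart p u))) (at p)"
    by (rule bounded_linear.has_derivative[OF bounded_linear_vw has_derivative_dd[OF diff_B[OF smooth_chart pB]]])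
  have g: "(G has_derivative (\<lambda>v. \<Sum>i\<in>UNIV. v $ i *\<^sub>R pd i G (vw (chart p)))) (at (vw (chart p)))"
    by (rule has_derivative_pd[OF Cinf_differentiable_at[OF G D img[OF p]]])
  have "dd F p u = dd (\<lambda>q. G (vw (chart q))) p u"
    by (rule arg_cong[where f = "\<lambda>D. D u"], rule dd_cong[OF N(1) p]) (rule F)
  moreover have "dd (\<lambda>q. G (vw (chart q))) p u = (\<Sum>i\<in>UNIV. vw (dd chart p u) $ i *\<^sub>R pd i G (vw (chart p)))"
    by (rule dd_eqI[OF has_derivative_compose[OF c g]])
  moreover have "\<dots> = vw (dd chart p u) $ 1 * pd 1 G (vw (chart p)) + vw (dd chart p u) $ 2 * pd 2 G (vw (chart p))"
    by (simp only: sum_2 real_scaleR_def)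
  moreover have "vw (dd chart p u) $ 1 = Re (\<theta> p u)" "vw (dd chart p u) $ 2 = Im (\<theta> p u)"
    by (simp_all add: vw_def dd_chart[OF pB])
  ultimately show ?thesis
    by (simp only: mult.commute)
qed

text \<open>The mixed second derivatives cancel, and the derivative of the integrating factor \<open>f\<close> produces
  exactly the rotation terms of the frame.\<close>
lemma laplacian_function_of_vw:
  fixes G :: "real^2 \<Rightarrow> real"
  assumes N: "open N" "N \<subseteq> B" and D: "open D" and G: "Cinf D G"
    and img: "\<And>q. q \<in> N \<Longrightarrow> vw (chart q) \<in> D"
    and F: "\<And>q. q \<in> N \<Longrightarrow> F q = G (vw (chart q))" and p: "p \<in> N"
  shows "dd (\<lambda>q. dd F q (V q)) p (V p) + dd (\<lambda>q. dd F q (W q)) p (W p)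
    = (cmod (f p))\<^sup>2 * laplacian G (vw (chart p)) - ow p * dd F p (V p) + ov p * dd F p (W p)"
proof -
  have pB: "p \<in> B" by (rule subsetD[OF N(2) p])
  define G1 G2 where "G1 q = pd 1 G (vw (chart q))" and "G2 q = pd 2 G (vw (chart q))" for q
  have dG1: "dd G1 p u = pd 1 (pd 1 G) (vw (chart p)) * Re (\<theta> p u) + pd 2 (pd 1 G) (vw (chart p)) * Im (\<theta> p u)" for u
    by (rule dd_function_of_vw[OF N D Cinf_pd[OF G] img _ p]) (simp_all add: G1_def)
  have dG2: "dd G2 p u = pd 1 (pd 2 G) (vw (chart p)) * Re (\<theta> p u) + pd 2 (pd 2 G) (vw (chart p)) * Im (\<theta> p u)" for u
    by (rule dd_function_of_vw[OF N D Cinf_pd[OF G] img _ p]) (simp_all add: G2_def)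
  have FV: "dd F q (V q) = G1 q * Re (f q) + G2 q * Im (f q)"
    and FW: "dd F q (W q) = G2 q * Re (f q) - G1 q * Im (f q)" if "q \<in> N" for q
    using dd_function_of_vw[OF N D G img F that, of "V q"] dd_function_of_vw[OF N D G img F that, of "W q"]
      subsetD[OF N(2) that] by (simp_all add: G1_def G2_def \<theta>_frame)
  have sG: "G1 differentiable at p" "G2 differentiable at p"
  proof -
    have "Cinf N (\<lambda>q. vw (chart q))"
      by (rule Cinf_bounded_linear[OF bounded_linear_vw N(1) Cinf_subset[OF smooth_chart N(2)]])
    then have *: "Cinf N (\<lambda>q. pd i G (vw (chart q)))" for i
      by (rule Cinf_compose[OF N(1) D _ Cinf_pd[OF G]]) (simp add: image_subset_iff img)
    have "Cinf N G1" "Cinf N G2"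
      unfolding G1_def[abs_def] G2_def[abs_def] by (rule *)+
    from this[THEN Cinf_differentiable_at, OF N(1) p]
    show "G1 differentiable at p" "G2 differentiable at p" .
  qed
  note d = sG diff_B[OF Cinf_Re[OF smooth_f] pB] diff_B[OF Cinf_Im[OF smooth_f] pB]
  have "dd (\<lambda>q. dd F q (V q)) p = dd (\<lambda>q. G1 q * Re (f q) + G2 q * Im (f q)) p"
    by (rule dd_cong[OF N(1) p FV])
  then have VV: "dd (\<lambda>q. dd F q (V q)) p (V p)
      = dd G1 p (V p) * Re (f p) + G1 p * Re (dd f p (V p)) + dd G2 p (V p) * Im (f p) + G2 p * Im (dd f p (V p))"
    by (simp add: dd_add dd_mult d differentiable_mult dd_Re dd_Im smooth_f pB)
  have "dd (\<lambda>q. dd F q (W q)) p = dd (\<lambda>q. G2 q * Re (f q) - G1 q * Im (f q)) p"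
    by (rule dd_cong[OF N(1) p FW])
  then have WW: "dd (\<lambda>q. dd F q (W q)) p (W p)
      = dd G2 p (W p) * Re (f p) + G2 p * Re (dd f p (W p)) - dd G1 p (W p) * Im (f p) - G1 p * Im (dd f p (W p))"
    by (simp add: dd_diff dd_mult d differentiable_mult dd_Re dd_Im smooth_f pB)
  have fVW: "Re (dd f p (V p)) - Im (dd f p (W p)) = - Re (f p) * ow p - Im (f p) * ov p"
    "Im (dd f p (V p)) + Re (dd f p (W p)) = Re (f p) * ov p - Im (f p) * ow p"
    using arg_cong[OF f_VW[OF pB], of Re] arg_cong[OF f_VW[OF pB], of Im] by simp_all
  \<comment> \<open>Solved for the V-derivatives of \<open>f\<close>; after substitution the
    W-derivatives cancel.\<close>
  have fVW': "Re (dd f p (V p)) = Im (dd f p (W p)) - Re (f p) * ow p - Im (f p) * ov p"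
    "Im (dd f p (V p)) = - Re (dd f p (W p)) + Re (f p) * ov p - Im (f p) * ow p"
    using fVW by linarith+
  show ?thesis
    unfolding VV WW FV[OF p] FW[OF p] dG1 dG2 \<theta>_frame[OF pB] fVW' laplacian_def sum_2 cmod_power2
    by (simp add: power2_eq_square) algebra
qed

end

subsection \<open>The coordinate chart\<close>

context S3_patch
begin

text \<open>The chart maps T to the first axis vector and has injective differential; hence the
  coordinate field of t is T.\<close>

lemma inverse_chart_T:
  assumes Q: "open Q" and q: "q \<in> Q" and g: "Cinf Q g"
    and inv: "\<And>y. y \<in> Q \<Longrightarrow> g y \<in> B" "\<And>y. y \<in> Q \<Longrightarrow> chart (g y) = y"
  shows "dd g q (axis 1 1) = T (g q)"
proof -
  have gB: "g q \<in> B" by (rule inv(1)[OF q])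
  have lin: "linear (dd chart (g q))" by (rule linear_dd[OF diff_B[OF smooth_chart gB]])
  have "dd chart (g q) (dd g q (axis 1 1)) = dd (\<lambda>y. chart (g y)) q (axis 1 1)"
    by (rule dd_eqI[OF has_derivative_compose, symmetric])
      (rule has_derivative_dd[OF Cinf_differentiable_at[OF g Q q]],
       rule has_derivative_dd[OF diff_B[OF smooth_chart gB]])
  also have "\<dots> = dd (\<lambda>y. y) q (axis 1 1)"
    by (rule arg_cong[where f = "\<lambda>D. D (axis 1 1)"], rule dd_cong[OF Q q]) (rule inv(2))
  also have "\<dots> = dd chart (g q) (T (g q))"
    by (simp add: dd_def dd_chart_T[OF gB, unfolded dd_def])
  finally have "dd chart (g q) (dd g q (axis 1 1) - T (g q)) = 0"
    by (simp add: linear_diff[OF lin])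
  from chart_immersive[OF gB this] show ?thesis by simp
qed

text \<open>Section of \<open>vw\<close> with values in the slice t = t(p0); functions constant
  along T become functions of (v, w) by restriction to it.\<close>

definition emb :: "real^2 \<Rightarrow> real^3" where
  "emb x = vector [chart p0 $ 1, x $ 1, x $ 2]"

lemma vw_emb: "vw (emb x) = x"
  by (simp add: vw_def emb_def vec_eq_iff forall_2)

lemma Cinf_emb: "open D \<Longrightarrow> Cinf D emb"
proof (rule Cinf_vecI)
  assume D: "open D"
  show "Cinf D (\<lambda>x. emb x $ i)" for i
    using exhaust_3[of i] Cinf_vec_nth[OF D Cinf_ident[OF D]] by (auto simp: emb_def)
qed

text \<open>In the chart T is the t-direction, so F has zero derivative on the segment from
  \<open>q\<close> to the slice, which convexity keeps inside \<open>Q\<close>.\<close>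

lemma constant_along_T:
  fixes F :: "real^3 \<Rightarrow> real"
  assumes Q: "open Q" "convex Q" and q: "q \<in> Q" "emb (vw q) \<in> Q" and g: "Cinf Q g"
    and inv: "\<And>y. y \<in> Q \<Longrightarrow> g y \<in> B" "\<And>y. y \<in> Q \<Longrightarrow> chart (g y) = y"
    and F: "Cinf B F" "\<And>p. p \<in> B \<Longrightarrow> dd F p (T p) = 0"
  shows "F (g q) = F (g (emb (vw q)))"
proof -
  define s where "s = chart p0 $ 1 - q $ 1"
  have e: "q + 1 *\<^sub>R (s *\<^sub>R axis 1 1) = emb (vw q)"
    by (simp add: s_def emb_def vw_def vec_eq_iff forall_3 axis_def)
  have mem: "q + t *\<^sub>R (s *\<^sub>R axis 1 1) \<in> Q" if "0 \<le> t" "t \<le> 1" for t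
    using convexD_alt[OF Q(2) q that] by (simp add: e[symmetric] algebra_simps)
  have lg: "linear (dd g y)" if "y \<in> Q" for y
    by (rule linear_dd[OF Cinf_differentiable_at[OF g Q(1) that]])
  have Fg: "((\<lambda>y. F (g y)) has_derivative (\<lambda>u. dd F (g y) (dd g y u))) (at y)" if "y \<in> Q" for y
    by (rule has_derivative_compose)
      (rule has_derivative_dd[OF Cinf_differentiable_at[OF g Q(1) that]],
       rule has_derivative_dd[OF diff_B[OF F(1) inv(1)[OF that]]])
  have "DERIV (\<lambda>t. F (g (q + t *\<^sub>R (s *\<^sub>R axis 1 1)))) t :> 0" if t: "0 \<le> t" "t \<le> 1" for t
  proof -
    define y where "y = q + t *\<^sub>R (s *\<^sub>R axis 1 1)"
    have y: "y \<in> Q" unfolding y_def by (rule mem[OF t])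
    have gT: "dd g y (axis 1 1) = T (g y)"
      by (rule inverse_chart_T[OF Q(1) y g inv])
    have "dd (\<lambda>y. F (g y)) y (s *\<^sub>R axis 1 1) = dd F (g y) (dd g y (s *\<^sub>R axis 1 1))"
      by (rule dd_eqI[OF Fg[OF y]])
    also have "\<dots> = s *\<^sub>R dd F (g y) (T (g y))"
      unfolding linear_cmul[OF lg[OF y]] gT
      by (rule linear_cmul[OF linear_dd[OF diff_B[OF F(1) inv(1)[OF y]]]])
    also have "\<dots> = 0" by (simp add: F(2) inv(1)[OF y])
    finally show ?thesis
      using has_vector_derivative_along_line[of "\<lambda>y. F (g y)", OF differentiableI[OF Fg[OF y, unfolded y_def]]]
      unfolding has_real_derivative_iff_has_vector_derivative y_def by simp
  qed
  from MVT2[OF zero_less_one this] show ?thesis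
    unfolding e[symmetric] by auto
qed

lemma zeta_ab: "p \<in> B \<Longrightarrow> Im (zeta p) * ((a p)\<^sup>2 + (b p)\<^sup>2) = - b p"
  and cmod_zeta_ab: "p \<in> B \<Longrightarrow> (cmod (zeta p))\<^sup>2 * ((a p)\<^sup>2 + (b p)\<^sup>2) = 1"
  and ab_pos: "p \<in> B \<Longrightarrow> (a p)\<^sup>2 + (b p)\<^sup>2 > 0"
proof -
  assume p: "p \<in> B"
  show pos: "(a p)\<^sup>2 + (b p)\<^sup>2 > 0"
    using nz[OF BU[OF p]] by (auto simp: sum_power2_gt_zero_iff)
  moreover have "Im (zeta p) = - b p / ((a p)\<^sup>2 + (b p)\<^sup>2)"
    by (simp add: zeta_def z_def)
  ultimately show "Im (zeta p) * ((a p)\<^sup>2 + (b p)\<^sup>2) = - b p"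
    by simp
  have eq: "(a p)\<^sup>2 + (b p)\<^sup>2 = (cmod (z p))\<^sup>2" by (simp add: z_def cmod_power2)
  show "(cmod (zeta p))\<^sup>2 * ((a p)\<^sup>2 + (b p)\<^sup>2) = 1"
    unfolding eq using z_nz[OF p] by (simp add: zeta_def norm_inverse power_inverse)
qed

lemma local_coordinates:
  "\<exists>N \<Omega> (\<psi> :: real^3 \<Rightarrow> real^3) (\<eta> :: real^2 \<Rightarrow> real) (k :: real^2 \<Rightarrow> real).
     open N \<and> p0 \<in> N \<and> N \<subseteq> U \<and> open \<Omega> \<and>
     \<psi> ` \<Omega> = N \<and> inj_on \<psi> \<Omega> \<and> Cinf \<Omega> \<psi> \<and> Cinf N (inv_into \<Omega> \<psi>) \<and>
     Cinf (vw ` \<Omega>) \<eta> \<and> Cinf (vw ` \<Omega>) k \<and>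
     (\<forall>q\<in>\<Omega>. let t = q $ 1; e = \<eta> (vw q) in
        alpha22 h T V (\<psi> q) = t / (t\<^sup>2 + e\<^sup>2) \<and>
        alpha23 h T V W (\<psi> q) = - e / (t\<^sup>2 + e\<^sup>2) \<and>
        m (\<psi> q) = exp (k (vw q)) / sqrt (t\<^sup>2 + e\<^sup>2)) \<and>
     (\<forall>x\<in>vw ` \<Omega>.
        laplacian \<eta> x = 2 * exp (- (2/3) * k x) * \<eta> x \<and>
        laplacian k x = 3 * exp (- (2/3) * k x) * (2 * exp (2 * k x) - 1))"
proof -
  obtain U' V' g where inv: "open U'" "U' \<subseteq> B" "p0 \<in> U'" "open V'" "homeomorphism U' V' chart g" "Cinf V' g"
    by (rule smooth_inverse_function[OF open_B smooth_chart p0_B chart_immersive])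
  have gV: "g y \<in> U'" "chart (g y) = y" if "y \<in> V'" for y
    using homeomorphism_apply2[OF inv(5) that] homeomorphism_image2[OF inv(5)] that by auto
  have cU: "chart u \<in> V'" "g (chart u) = u" if "u \<in> U'" for u
    using homeomorphism_apply1[OF inv(5) that] homeomorphism_image1[OF inv(5)] that by auto
  define y where "y = chart p0"
  obtain e where e: "e > 0" "ball y e \<subseteq> V'"
    by (rule openE[OF inv(4) cU(1)[OF inv(3)], folded y_def])
  \<comment> \<open>A box, so that its image under \<open>vw\<close> is again a box and
    \<open>emb\<close> maps that image back into it. The half-width e/3 bounds the sum of the three
    coordinate differences by e, hence the box lies in the ball.\<close>
  define \<Omega> where "\<Omega> = box (\<chi> i. y $ i - e / 3) (\<chi> i. y $ i + e / 3)"
  have mem\<Omega>: "q \<in> \<Omega> \<longleftrightarrow> (\<forall>i. \<bar>q $ i - y $ i\<bar> < e / 3)" for q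
    by (simp only: \<Omega>_def mem_box_cart abs_diff_less_iff vec_lambda_beta)
  define D where "D = box (vector [y $ 2 - e / 3, y $ 3 - e / 3]) (vector [y $ 2 + e / 3, y $ 3 + e / 3] :: real^2)"
  have \<Omega>: "open \<Omega>" "convex \<Omega>" and D: "open D"
    by (simp_all add: \<Omega>_def D_def open_box convex_box)
  have \<Omega>V: "\<Omega> \<subseteq> V'"
  proof
    fix q assume "q \<in> \<Omega>"
    have "norm (q - y) \<le> (\<Sum>i\<in>UNIV. \<bar>(q - y) $ i\<bar>)" by (rule norm_le_l1_cart)
    also have "\<dots> < e" using \<open>q \<in> \<Omega>\<close> by (simp add: mem\<Omega> sum_3 forall_3)
    finally show "q \<in> V'" using e(2) by (auto simp: dist_norm norm_minus_commute)
  qed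
  have gB: "g q \<in> B" and cg: "chart (g q) = q" if "q \<in> \<Omega>" for q
    using gV[OF subsetD[OF \<Omega>V that]] subsetD[OF inv(2)] by simp_all
  have memD: "x \<in> D \<longleftrightarrow> \<bar>x $ 1 - y $ 2\<bar> < e / 3 \<and> \<bar>x $ 2 - y $ 3\<bar> < e / 3" for x
    unfolding D_def mem_box_cart forall_2 abs_diff_less_iff by auto
  have emb\<Omega>: "emb x \<in> \<Omega>" if "x \<in> D" for x
    using that e(1) by (simp add: mem\<Omega> memD forall_3 emb_def y_def)
  have vwD: "vw q \<in> D" if "q \<in> \<Omega>" for q
    using that by (simp add: mem\<Omega> memD forall_3 vw_def)
  have vw\<Omega>: "vw ` \<Omega> = D"
  proof
    show "vw ` \<Omega> \<subseteq> D" using vwD by blast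
    show "D \<subseteq> vw ` \<Omega>"
    proof
      show "x \<in> vw ` \<Omega>" if "x \<in> D" for x
        using image_eqI[of x vw "emb x" \<Omega>] emb\<Omega>[OF that] by (simp add: vw_emb)
    qed
  qed
  have g\<Omega>: "Cinf \<Omega> g" by (rule Cinf_subset[OF inv(6) \<Omega>V])
  define N where "N = g ` \<Omega>"
  have N_eq: "N = U' \<inter> chart -` \<Omega>"
  proof (intro equalityI subsetI)
    fix p assume "p \<in> N"
    then obtain q where "q \<in> \<Omega>" "p = g q" by (auto simp: N_def)
    then show "p \<in> U' \<inter> chart -` \<Omega>" using gV[OF subsetD[OF \<Omega>V]] by simp
  next
    fix p assume "p \<in> U' \<inter> chart -` \<Omega>"
    then show "p \<in> N" unfolding N_def by (intro image_eqI[of p g "chart p"]) (simp_all add: cU)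
  qed
  have "continuous_on U' chart"
    by (rule continuous_on_subset[OF Cinf_continuous_on[OF smooth_chart] inv(2)])
  then have openN: "open N"
    unfolding N_eq by (rule continuous_open_preimage[OF _ inv(1) \<Omega>(1)])
  have p0N: "p0 \<in> N"
    using inv(3) e(1) by (simp add: N_eq mem\<Omega> y_def)
  have NB: "N \<subseteq> B" using inv(2) by (auto simp: N_eq)
  have cN: "chart p \<in> \<Omega>" "g (chart p) = p" if "p \<in> N" for p
    using that cU by (auto simp: N_eq)
  have inj: "inj_on g \<Omega>" by (rule inj_on_inverseI[of _ chart]) (rule cg)
  have Ninv: "Cinf N (inv_into \<Omega> g)"
  proof (rule Cinf_cong_imp[OF openN])
    show "Cinf N chart" by (rule Cinf_subset[OF smooth_chart NB])
    show "chart p = inv_into \<Omega> g p" if "p \<in> N" for p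
      using inv_into_f_f[OF inj cN(1)[OF that]] cN(2)[OF that] by simp
  qed
  \<comment> \<open>A function killed by T agrees on the box with its restriction to the slice,
    composed with \<open>vw\<close>.\<close>
  have descend: "Cinf D (\<lambda>x. F (g (emb x)))"
    and descend_eq: "\<And>q. q \<in> \<Omega> \<Longrightarrow> F (g q) = F (g (emb (vw q)))"
    if F: "Cinf B F" "\<And>p. p \<in> B \<Longrightarrow> dd F p (T p) = 0" for F :: "real^3 \<Rightarrow> real"
  proof -
    have "Cinf D (\<lambda>x. g (emb x))"
      by (rule Cinf_compose[OF D \<Omega>(1) Cinf_emb[OF D] g\<Omega>]) (use emb\<Omega> in blast)
    then show "Cinf D (\<lambda>x. F (g (emb x)))"
      by (rule Cinf_compose[OF D open_B _ F(1)]) (use emb\<Omega> gB in blast)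
    show "F (g q) = F (g (emb (vw q)))" if "q \<in> \<Omega>" for q
      by (rule constant_along_T[OF \<Omega> that emb\<Omega>[OF vwD[OF that]] g\<Omega> gB cg F])
  qed
  define \<eta> where "\<eta> x = Im (zeta (g (emb x)))" for x
  define \<kappa> where "\<kappa> x = k (g (emb x))" for x
  have s\<eta>: "Cinf D \<eta>" and s\<kappa>: "Cinf D \<kappa>"
    using descend[OF Cinf_Im[OF smooth_zeta] eta_T] descend[OF smooth_k k_T]
    by (simp_all add: \<eta>_def[abs_def] \<kappa>_def[abs_def])
  have e\<eta>: "Im (zeta (g q)) = \<eta> (vw q)" and e\<kappa>: "k (g q) = \<kappa> (vw q)" if "q \<in> \<Omega>" for q
    using descend_eq[OF Cinf_Im[OF smooth_zeta] eta_T that] descend_eq[OF smooth_k k_T that]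
    by (simp_all add: \<eta>_def \<kappa>_def)
  have N\<eta>: "Im (zeta p) = \<eta> (vw (chart p))" and N\<kappa>: "k p = \<kappa> (vw (chart p))" if "p \<in> N" for p
    using e\<eta>[OF cN(1)[OF that]] e\<kappa>[OF cN(1)[OF that]] cN(2)[OF that] by simp_all
  have img: "vw (chart p) \<in> D" if "p \<in> N" for p
    using cN(1)[OF that] vwD by blast
  have lap: "laplacian \<eta> x = 2 * exp (- (2/3) * \<kappa> x) * \<eta> x"
    "laplacian \<kappa> x = 3 * exp (- (2/3) * \<kappa> x) * (2 * exp (2 * \<kappa> x) - 1)" if "x \<in> D" for x
  proof -
    define p where "p = g (emb x)"
    have p: "p \<in> N" and pB: "p \<in> B" and px: "vw (chart p) = x"
      using emb\<Omega>[OF that] gB cg vw_emb by (auto simp: p_def N_def)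
    \<comment> \<open>This is |z|^2, a common factor: |f|^2 = e^(2k/3) |z|^2, b = -\<eta> |z|^2 and
      m^2 = e^(2k) |z|^2. Cancelling it leaves equations in (v, w) alone.\<close>
    let ?s = "(a p)\<^sup>2 + (b p)\<^sup>2"
    have s': "?s \<noteq> 0" using ab_pos[OF pB] by linarith
    have E: "exp (- (2/3) * \<kappa> x) * exp (2/3 * \<kappa> x) = 1"
      by (simp flip: exp_add)
    have E2: "(m p)\<^sup>2 = exp (2 * \<kappa> x) * ?s"
    proof -
      have "(m p * cmod (zeta p))\<^sup>2 = exp (2 * \<kappa> x)"
        unfolding cmod_zeta[OF pB] exp_double using N\<kappa>[OF p] px by simp
      then have "exp (2 * \<kappa> x) * ?s = (m p)\<^sup>2 * ((cmod (zeta p))\<^sup>2 * ?s)"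
        by (simp add: power_mult_distrib)
      then show ?thesis by (simp only: cmod_zeta_ab[OF pB] mult_1_right)
    qed
    have norm: "(cmod (f p))\<^sup>2 = exp (2/3 * \<kappa> x) * ?s"
      using norm_f[OF pB] N\<kappa>[OF p] px by simp
    have "exp (2/3 * \<kappa> x) * ?s * laplacian \<eta> x = - 2 * b p"
      using laplacian_function_of_vw[OF openN NB D s\<eta> img N\<eta> p] laplace_eta[OF pB] px norm by simp
    also have "\<dots> = 2 * \<eta> x * ?s"
      using zeta_ab[OF pB] N\<eta>[OF p] px by simp
    finally have "exp (2/3 * \<kappa> x) * laplacian \<eta> x = 2 * \<eta> x"
      using mult_left_cancel[OF s', of "exp (2/3 * \<kappa> x) * laplacian \<eta> x" "2 * \<eta> x"] by algebra
    then show "laplacian \<eta> x = 2 * exp (- (2/3) * \<kappa> x) * \<eta> x"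
      using E by algebra
    have "exp (2/3 * \<kappa> x) * ?s * laplacian \<kappa> x = 6 * (m p)\<^sup>2 - 3 * ?s"
      using laplacian_function_of_vw[OF openN NB D s\<kappa> img N\<kappa> p] laplace_k[OF pB] px norm by simp
    then have "exp (2/3 * \<kappa> x) * laplacian \<kappa> x = 6 * exp (2 * \<kappa> x) - 3"
      using mult_left_cancel[OF s', of "exp (2/3 * \<kappa> x) * laplacian \<kappa> x" "6 * exp (2 * \<kappa> x) - 3"]
      unfolding E2 by algebra
    then show "laplacian \<kappa> x = 3 * exp (- (2/3) * \<kappa> x) * (2 * exp (2 * \<kappa> x) - 1)"
      using E by algebra
  qed
  have inv_fun: "let t = q $ 1; e = \<eta> (vw q) in
        alpha22 h T V (g q) = t / (t\<^sup>2 + e\<^sup>2) \<and>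
        alpha23 h T V W (g q) = - e / (t\<^sup>2 + e\<^sup>2) \<and>
        m (g q) = exp (\<kappa> (vw q)) / sqrt (t\<^sup>2 + e\<^sup>2)" if q: "q \<in> \<Omega>" for q
  proof -
    have "Re (zeta (g q)) = q $ 1"
      using chart_nth(1)[of "g q"] cg[OF q] by simp
    then show ?thesis
      using a_chart[OF gB[OF q]] b_chart[OF gB[OF q]] m_chart[OF gB[OF q]] e\<eta>[OF q] e\<kappa>[OF q]
      by (simp add: alpha22_def alpha23_def cf_def)
  qed
  have NU: "N \<subseteq> U" using NB B(3) by (rule subset_trans)
  show ?thesis
    by (rule exI[of _ N], rule exI[of _ \<Omega>], rule exI[of _ g], rule exI[of _ \<eta>], rule exI[of _ \<kappa>],
        unfold vw\<Omega>, intro conjI ballI openN p0N NU \<Omega>(1) inj g\<Omega> Ninv s\<eta> s\<kappa> inv_fun lap N_def[symmetric])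
qed

end

text \<open>The quotient z(p0) / z(p) is continuous and equals 1 at \<open>p0\<close>, hence stays
  in the open slit plane on a small ball.\<close>

lemma (in S3_hypersphere) S3_patch_exists:
  assumes nz: "\<And>p. p \<in> U \<Longrightarrow> (a p, b p) \<noteq> (0, 0)" and p0: "p0 \<in> U"
  shows "\<exists>r. S3_patch U \<phi> \<xi> h \<Gamma> S T V W m (ball p0 r) p0 r"
proof -
  define z where "z p = of_real (a p) + \<i> * of_real (b p)" for p
  have z: "z p \<noteq> 0" if "p \<in> U" for p
    using nz[OF that] by (auto simp: z_def complex_eq_iff)
  have "continuous_on U z"
    unfolding z_def[abs_def] by (intro continuous_intros Cinf_continuous_on smooth_coeffs)
  then have "continuous_on U (\<lambda>p. z p0 / z p)"
    using z by (intro continuous_intros) auto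
  then have "open (U \<inter> (\<lambda>p. z p0 / z p) -` (- \<real>\<^sub>\<le>\<^sub>0))"
    by (rule continuous_open_preimage[OF _ open_U]) (simp add: open_Compl)
  moreover have "p0 \<in> U \<inter> (\<lambda>p. z p0 / z p) -` (- \<real>\<^sub>\<le>\<^sub>0)"
    using p0 z[OF p0] by (simp add: complex_nonpos_Reals_iff)
  ultimately obtain r where "r > 0" "ball p0 r \<subseteq> U \<inter> (\<lambda>p. z p0 / z p) -` (- \<real>\<^sub>\<le>\<^sub>0)"
    using open_contains_ball by blast
  then have "S3_patch U \<phi> \<xi> h \<Gamma> S T V W m (ball p0 r) p0 r"
    by unfold_locales (use nz in \<open>auto simp: z_def Complex_eq\<close>)
  then show ?thesis by blast
qed

theorem theorem7p28:
  fixes U :: "(real^3) set"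
    and \<phi> \<xi> :: "real^3 \<Rightarrow> real^4"
    and h :: "real^3 \<Rightarrow> real^3 \<Rightarrow> real^3 \<Rightarrow> real"
    and \<Gamma> :: "real^3 \<Rightarrow> real^3 \<Rightarrow> real^3 \<Rightarrow> real^3"
    and S :: "real^3 \<Rightarrow> real^3 \<Rightarrow> real^3"
    and T V W :: "real^3 \<Rightarrow> real^3"
    and a6 :: "real^3 \<Rightarrow> real"
  assumes blaschke: "blaschke_structure U \<phi> \<xi> h \<Gamma> S"
    and improper: "improper_affine_hypersphere U S"
    and indef: "indefinite U h"
    and sym: "pointwise_S3_symmetry U h (diff_tensor h \<Gamma>)"
    and frame: "S3_frame U h (diff_tensor h \<Gamma>) T V W a6"
    and nonzero: "\<forall>p\<in>U. (alpha22 h T V p, alpha23 h T V W p) \<noteq> (0, 0)"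
  shows "\<forall>p\<in>U. \<exists>N \<Omega> (\<psi> :: real^3 \<Rightarrow> real^3) (\<eta> :: real^2 \<Rightarrow> real) (k :: real^2 \<Rightarrow> real).
           open N \<and> p \<in> N \<and> N \<subseteq> U \<and> open \<Omega> \<and>
           \<psi> ` \<Omega> = N \<and> inj_on \<psi> \<Omega> \<and> Cinf \<Omega> \<psi> \<and> Cinf N (inv_into \<Omega> \<psi>) \<and>
           Cinf (vw ` \<Omega>) \<eta> \<and> Cinf (vw ` \<Omega>) k \<and>
           (\<forall>q\<in>\<Omega>. let t = q $ 1; e = \<eta> (vw q) in
              alpha22 h T V (\<psi> q) = t / (t\<^sup>2 + e\<^sup>2) \<and>
              alpha23 h T V W (\<psi> q) = - e / (t\<^sup>2 + e\<^sup>2) \<and>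
              a6 (\<psi> q) = exp (k (vw q)) / sqrt (t\<^sup>2 + e\<^sup>2)) \<and>
           (\<forall>x\<in>vw ` \<Omega>.
              laplacian \<eta> x = 2 * exp (- (2/3) * k x) * \<eta> x \<and>
              laplacian k x = 3 * exp (- (2/3) * k x) * (2 * exp (2 * k x) - 1))"
proof
  fix p assume p: "p \<in> U"
  interpret S3_hypersphere U \<phi> \<xi> h \<Gamma> S T V W a6
    by unfold_locales (fact blaschke improper frame)+
  have "(a p, b p) \<noteq> (0, 0)" if "p \<in> U" for p
    using nonzero that by (simp add: alpha22_def alpha23_def cf_def)
  then obtain r where "S3_patch U \<phi> \<xi> h \<Gamma> S T V W a6 (ball p r) p r"
    using S3_patch_exists p by blast
  then show "\<exists>N \<Omega> (\<psi> :: real^3 \<Rightarrow> real^3) (\<eta> :: real^2 \<Rightarrow> real) (k :: real^2 \<Rightarrow> real).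
           open N \<and> p \<in> N \<and> N \<subseteq> U \<and> open \<Omega> \<and>
           \<psi> ` \<Omega> = N \<and> inj_on \<psi> \<Omega> \<and> Cinf \<Omega> \<psi> \<and> Cinf N (inv_into \<Omega> \<psi>) \<and>
           Cinf (vw ` \<Omega>) \<eta> \<and> Cinf (vw ` \<Omega>) k \<and>
           (\<forall>q\<in>\<Omega>. let t = q $ 1; e = \<eta> (vw q) in
              alpha22 h T V (\<psi> q) = t / (t\<^sup>2 + e\<^sup>2) \<and>
              alpha23 h T V W (\<psi> q) = - e / (t\<^sup>2 + e\<^sup>2) \<and>
              a6 (\<psi> q) = exp (k (vw q)) / sqrt (t\<^sup>2 + e\<^sup>2)) \<and>
           (\<forall>x\<in>vw ` \<Omega>.
              laplacian \<eta> x = 2 * exp (- (2/3) * k x) * \<eta> x \<and>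
              laplacian k x = 3 * exp (- (2/3) * k x) * (2 * exp (2 * k x) - 1))"
    by (rule S3_patch.local_coordinates)
qed

end
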